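(* There exists $\gamma>0$, depending only on $n$, $\kappa_1$, $\delta$ and $s_1$, such that if $\|g\|_{L^{n/(2s_1)}(Q)}\le\gamma$, then for every $p\in\mathbb{R}^n$ there exists $u\in\mathcal W$ such that $\mathcal E_p(u)=\min_{\mathcal W}\mathcal E_p$ (and this minimum is finite), and moreover $u\in L^{\frac{n}{n-2s_1}}(Q)$.
   Context: Standing assumptions: $n\ge2$, $Q=(0,1)^n$. The kernel $K:\mathbb{R}^n\times\mathbb{R}^n\to[0,\infty)$ is measurable and satisfies: (K1) $K(y,x)=K(x,y)=K(x+w,y+w)=K(Rx,Ry)$ for all $x,y,w\in\mathbb{R}^n$ and all $R\in SO(n)$; (K2) $\int_{\mathbb{R}^n}|h|\,K(h,0)\,dh<\infty$; (K3) there are constants $0<s_1<\tfrac12<s_2<1$, $\delta>0$ and $0<\kappa_1\le\kappa_2$ such that $\kappa_1\,\chi_{(0,\delta)}(|x-y|)\,|x-y|^{-n-2s_1}\le K(x,y)\le\kappa_2\min\{|x-y|^{-n-2s_1},|x-y|^{-n-2s_2}\}$ for all $x\neq y$; (K4) $\inf_{(x,y)\in Q\times Q}K(x,y)\ge\kappa_3$ for some constant $\kappa_3>0$. The forcing term $g\in L^\infty(\mathbb{R}^n)$ is $\mathbb{Z}^n$-periodic with $\int_Q g(x)\,dx=0$. Cell problem: $\mathcal W=\{u\in L^1_{\rm loc}(\mathbb{R}^n):\ u \text{ is } \mathbb{Z}^n\text{-periodic},\ \int_Q u=0\}$, and for $p\in\mathbb{R}^n$, $\mathcal E_p(u)=\iint_{Q\times\mathbb{R}^n}\tfrac12|u(x)-u(y)+p\cdot(x-y)|\,K(x,y)\,dx\,dy+\int_Q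 g(x)u(x)\,dx$. *)

theory Defs
  imports "HOL-Analysis.Analysis"
begin

definition unit_cube :: "(real^'n) set" where
  "unit_cube = box 0 One"

definition Zn_periodic :: "(real^'n \<Rightarrow> 'b) \<Rightarrow> bool" where
  "Zn_periodic f \<longleftrightarrow> (\<forall>x k. (\<forall>i. k $ i \<in> \<int>) \<longrightarrow> f (x + k) = f x)"

definition rotation_matrix :: "real^'n^'n \<Rightarrow> bool" where
  "rotation_matrix R \<longleftrightarrow> orthogonal_matrix R \<and> det R = 1"

definition cell_space :: "(real^'n \<Rightarrow> real) set" where
  "cell_space = {u. (\<forall>C. compact C \<longrightarrow> set_integrable lebesgue C u)
                    \<and> Zn_periodic u
                    \<and> (LINT x:unit_cube|lebesgue. u x) = 0}"

text \<open>The energy E_p(u), with values in (-inf, +inf]. The double integral over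
  Q x R^n is taken w.r.t. Lebesgue measure on R^n x R^n = R^(2n).\<close>
definition cell_energy ::
  "(real^'n \<Rightarrow> real^'n \<Rightarrow> real) \<Rightarrow> (real^'n \<Rightarrow> real) \<Rightarrow> real^'n \<Rightarrow> (real^'n \<Rightarrow> real) \<Rightarrow> ereal" where
  "cell_energy K g p u =
     enn2ereal (\<integral>\<^sup>+ z. indicator (unit_cube \<times> UNIV) z *
        ennreal (\<bar>u (fst z) - u (snd z) + p \<bullet> (fst z - snd z)\<bar> * K (fst z) (snd z) / 2) \<partial>lebesgue)
     + ereal (LINT x:unit_cube|lebesgue. g x * u x)"

definition kernel_K0 :: "(real^'n \<Rightarrow> real^'n \<Rightarrow> real) \<Rightarrow> bool" where
  "kernel_K0 K \<longleftrightarrow> (\<lambda>z. K (fst z) (snd z)) \<in> borel_measurable (lebesgue :: ((real^'n) \<times> (real^'n)) measure)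
                   \<and> (\<forall>x y. 0 \<le> K x y)"

definition kernel_K1 :: "(real^'n \<Rightarrow> real^'n \<Rightarrow> real) \<Rightarrow> bool" where
  "kernel_K1 K \<longleftrightarrow> (\<forall>x y. K y x = K x y)
                 \<and> (\<forall>x y w. K (x + w) (y + w) = K x y)
                 \<and> (\<forall>x y R. rotation_matrix R \<longrightarrow> K (R *v x) (R *v y) = K x y)"

definition kernel_K2 :: "(real^'n \<Rightarrow> real^'n \<Rightarrow> real) \<Rightarrow> bool" where
  "kernel_K2 K \<longleftrightarrow> (\<integral>\<^sup>+ h. ennreal (norm h * K h 0) \<partial>lebesgue) < \<infinity>"

definition kernel_K3 ::
  "(real^'n \<Rightarrow> real^'n \<Rightarrow> real) \<Rightarrow> real \<Rightarrow> real \<Rightarrow> real \<Rightarrow> real \<Rightarrow> real \<Rightarrow> bool" where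
  "kernel_K3 K s1 s2 \<delta> \<kappa>1 \<kappa>2 \<longleftrightarrow>
     0 < s1 \<and> s1 < 1/2 \<and> 1/2 < s2 \<and> s2 < 1 \<and> 0 < \<delta> \<and> 0 < \<kappa>1 \<and> \<kappa>1 \<le> \<kappa>2 \<and>
     (\<forall>x y. x \<noteq> y \<longrightarrow>
        (if dist x y < \<delta> then \<kappa>1 * dist x y powr (- (real CARD('n) + 2 * s1)) else 0) \<le> K x y
        \<and> K x y \<le> \<kappa>2 * min (dist x y powr (- (real CARD('n) + 2 * s1)))
                               (dist x y powr (- (real CARD('n) + 2 * s2))))"

definition kernel_K4 :: "(real^'n \<Rightarrow> real^'n \<Rightarrow> real) \<Rightarrow> real \<Rightarrow> bool" where
  "kernel_K4 K \<kappa>3 \<longleftrightarrow> 0 < \<kappa>3 \<and> (\<forall>x\<in>unit_cube. \<forall>y\<in>unit_cube. \<kappa>3 \<le> K x y)"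

definition admissible_forcing :: "(real^'n \<Rightarrow> real) \<Rightarrow> bool" where
  "admissible_forcing g \<longleftrightarrow> g \<in> borel_measurable lebesgue
     \<and> (\<exists>M. AE x in lebesgue. \<bar>g x\<bar> \<le> M)
     \<and> Zn_periodic g
     \<and> (LINT x:unit_cube|lebesgue. g x) = 0"

end

theory Submission
  imports Defs
begin

text \<open>
  Direct method. Write \<open>\<alpha> = 2 s\<^sub>1\<close>, \<open>q = n / (n - \<alpha>)\<close>, and let \<open>[u]\<close> be the double integral of
  \<open>|u x - u y| |x - y| powr (- n - \<alpha>)\<close> over the pairs in \<open>Q \<times> Q\<close> with \<open>|x - y| < \<delta>\<close>, which the
  energy controls by (K3).

  \<^item> Poincare: joining \<open>x\<close> to \<open>y\<close> by \<open>N\<close> equal steps shorter than \<open>\<delta>\<close> inside the convex cube bounds the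
    double integral of \<open>|u x - u y|\<close> by \<open>C [u]\<close>; for mean zero \<open>u\<close> it dominates the \<open>L\<^sup>1\<close> norm.

  \<^item> Sobolev: put \<open>S = \<integral> |u|\<^sup>q\<close>. By Chebyshev, at least half of a subcube containing \<open>x\<close> of volume
    \<open>2 S (2 / |u x|)\<^sup>q\<close> satisfies \<open>|u y| < |u x| / 2\<close>. Since \<open>q \<alpha> / n = q - 1\<close>, this gives
    \<open>|u x|\<^sup>q \<le> C S powr (\<alpha> / n) * \<integral> |u x - u y| |x - y| powr (- n - \<alpha>) dy\<close>, with an additional \<open>|u x|\<close>
    when that subcube would be too large; integrating yields \<open>S powr (1 / q) \<le> C ([u] + \<parallel>u\<parallel>\<^sub>1)\<close>.

  \<^item> Hoelder's inequality then absorbs the forcing term into half of the interaction energy once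
    \<open>\<gamma> = \<kappa>\<^sub>1 / (4 C)\<close>, so minimizing sequences have bounded \<open>[u]\<close>.

  \<^item> Compactness in \<open>L\<^sup>1\<close>: on a grid of mesh \<open>1 / m\<close> the \<open>L\<^sup>1\<close> norm is at most \<open>C m powr (- \<alpha>) [u]\<close> plus
    the absolute integrals over the cells, and countably many cell integrals converge along a
    subsequence. Fatou's lemma finishes the proof.
\<close>

section \<open>Changes of variables for Lebesgue integrals, and elementary geometry of the unit
  cube\<close>

lemma nn_integral_lborel_translation:
  fixes f :: "'a::euclidean_space \<Rightarrow> ennreal"
  assumes [measurable]: "f \<in> borel_measurable borel"
  shows "(\<integral>\<^sup>+x. f (a + x) \<partial>lborel) = (\<integral>\<^sup>+x. f x \<partial>lborel)"
proof -
  have "(\<integral>\<^sup>+x. f x \<partial>lborel) = (\<integral>\<^sup>+x. f x \<partial>distr lborel borel ((+) a))"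
    by (simp add: lborel_distr_plus)
  also have "\<dots> = (\<integral>\<^sup>+x. f (a + x) \<partial>lborel)"
    by (rule nn_integral_distr) auto
  finally show ?thesis by simp
qed

lemma nn_integral_lborel_scaling:
  fixes f :: "'a::euclidean_space \<Rightarrow> ennreal"
  assumes [measurable]: "f \<in> borel_measurable borel" and "c > 0"
  shows "(\<integral>\<^sup>+x. f (x /\<^sub>R c) \<partial>lborel) = ennreal (c ^ DIM('a)) * (\<integral>\<^sup>+x. f x \<partial>lborel)"
proof -
  have "(\<integral>\<^sup>+x. f (x /\<^sub>R c) \<partial>lborel)
      = (\<integral>\<^sup>+x. f (x /\<^sub>R c) \<partial>density (distr lborel borel (\<lambda>x::'a. 0 + c *\<^sub>R x)) (\<lambda>_. \<bar>c\<bar>^DIM('a)))"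
    using lborel_affine[of c "0::'a"] \<open>c > 0\<close> by simp
  also have "\<dots> = (\<integral>\<^sup>+x. ennreal (c ^ DIM('a)) * f x \<partial>lborel)"
    using \<open>c > 0\<close> by (subst nn_integral_density) (auto simp: nn_integral_distr)
  also have "\<dots> = ennreal (c ^ DIM('a)) * (\<integral>\<^sup>+x. f x \<partial>lborel)"
    by (rule nn_integral_cmult) auto
  finally show ?thesis .
qed

lemma One_cart: "(One :: real^'n) $ i = 1"
  by (simp only: cart_eq_inner_axis) (simp add: inner_sum_left_Basis axis_in_Basis_iff)

lemma mem_unit_cube:
  fixes x :: "real^'n"
  shows "x \<in> unit_cube \<longleftrightarrow> (\<forall>i. 0 < x $ i \<and> x $ i < 1)"
  unfolding unit_cube_def by (simp only: mem_box_cart zero_index One_cart)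

lemma unit_cube_borel [measurable]: "unit_cube \<in> sets borel"
  unfolding unit_cube_def by simp

lemma emeasure_unit_cube: "emeasure lborel (unit_cube :: (real^'n) set) = 1"
  unfolding unit_cube_def by (simp add: emeasure_lborel_box_eq)

lemma convex_unit_cube: "convex unit_cube"
  unfolding unit_cube_def by simp

text \<open>The Euclidean norm is at most the sum of the absolute coordinates. The resulting factor
  \<open>CARD('n)\<close> enters every distance bound below: for the cube, its subcubes and the grid
  cells.\<close>

lemma norm_le_card_mult:
  fixes z :: "real^'n"
  assumes "\<And>i. \<bar>z $ i\<bar> \<le> r"
  shows "norm z \<le> real CARD('n) * r"
proof -
  have "norm z \<le> (\<Sum>i\<in>UNIV. \<bar>z $ i\<bar>)" by (rule norm_le_l1_cart)
  also have "\<dots> \<le> (\<Sum>i\<in>(UNIV::'n set). r)" by (rule sum_mono) (use assms in auto)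
  finally show ?thesis by simp
qed

lemma norm_diff_unit_cube:
  fixes x y :: "real^'n"
  assumes "x \<in> unit_cube" "y \<in> unit_cube"
  shows "norm (x - y) \<le> real CARD('n)"
  using norm_le_card_mult[of "x - y" 1] assms
  by (auto simp: mem_unit_cube abs_le_iff) (smt (verit) mem_unit_cube)

subsection \<open>A fractional Poincare inequality on the cube\<close>

text \<open>Up to the factor \<kappa>1 this is the lower bound in \<open>kernel_K3\<close> with
  \<alpha> equal to twice \<open>s1\<close>. Because \<open>0 powr a = 0\<close>, it vanishes at the
  origin, so pairs on the diagonal need separate care.\<close>

definition frac_kernel :: "real \<Rightarrow> real \<Rightarrow> real^'n \<Rightarrow> real" where
  "frac_kernel \<alpha> \<delta> h = (if norm h < \<delta> then norm h powr (- (real CARD('n) + \<alpha>)) else 0)"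

lemma frac_kernel_measurable [measurable]: "frac_kernel \<alpha> \<delta> \<in> borel_measurable borel"
  unfolding frac_kernel_def[abs_def] by measurable

lemma frac_kernel_nonneg [simp]: "0 \<le> frac_kernel \<alpha> \<delta> h"
  unfolding frac_kernel_def by simp

lemma frac_kernel_minus [simp]: "frac_kernel \<alpha> \<delta> (- h) = frac_kernel \<alpha> \<delta> h"
  unfolding frac_kernel_def by simp

lemma frac_kernel_ge:
  fixes h :: "real^'n"
  assumes "h \<noteq> 0" "norm h \<le> d" "d < \<delta>" "0 < \<alpha>"
  shows "d powr (- (real CARD('n) + \<alpha>)) \<le> frac_kernel \<alpha> \<delta> h"
  using assms unfolding frac_kernel_def by (auto intro!: powr_mono2')

text \<open>A truncated Gagliardo seminorm of order \<alpha> and exponent 1. As an iterated integral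
  in \<open>ennreal\<close> it may be infinite and presupposes no integrability of
  \<open>u\<close>.\<close>

definition frac_seminorm :: "real \<Rightarrow> real \<Rightarrow> (real^'n \<Rightarrow> real) \<Rightarrow> ennreal" where
  "frac_seminorm \<alpha> \<delta> u = (\<integral>\<^sup>+x\<in>unit_cube. (\<integral>\<^sup>+y\<in>unit_cube.
      ennreal (\<bar>u x - u y\<bar> * frac_kernel \<alpha> \<delta> (x - y)) \<partial>lborel) \<partial>lborel)"

text \<open>The two double integrals compared in the Poincare inequality are both weighted integrals
  of this quantity in \<open>h\<close>, which reduces the comparison to that of \<open>h\<close>
  with a fraction of \<open>h\<close>.\<close>

definition increment_norm :: "(real^'n \<Rightarrow> real) \<Rightarrow> real^'n \<Rightarrow> ennreal" where
  "increment_norm u h = (\<integral>\<^sup>+x. indicator unit_cube x * indicator unit_cube (x + h) *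
      ennreal \<bar>u x - u (x + h)\<bar> \<partial>lborel)"

lemma increment_norm_measurable [measurable]:
  assumes [measurable]: "u \<in> borel_measurable borel"
  shows "increment_norm u \<in> borel_measurable borel"
  unfolding increment_norm_def[abs_def] by measurable

text \<open>Substitute \<open>y = x + h\<close> in the inner integral and exchange the order of
  integration; evenness turns the weight \<open>k (- h)\<close> into \<open>k h\<close>.\<close>

lemma double_integral_increments:
  fixes u :: "real^'n \<Rightarrow> real"
  assumes [measurable]: "u \<in> borel_measurable borel" "k \<in> borel_measurable borel"
    and even: "\<And>h. k (- h) = k h" and k: "\<And>h. 0 \<le> k h"
  shows "(\<integral>\<^sup>+x\<in>unit_cube. (\<integral>\<^sup>+y\<in>unit_cube. ennreal (\<bar>u x - u y\<bar> * k (x - y)) \<partial>lborel) \<partial>lborel)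
       = (\<integral>\<^sup>+h. ennreal (k h) * increment_norm u h \<partial>lborel)"
proof -
  have "(\<integral>\<^sup>+x\<in>unit_cube. (\<integral>\<^sup>+y\<in>unit_cube. ennreal (\<bar>u x - u y\<bar> * k (x - y)) \<partial>lborel) \<partial>lborel)
      = (\<integral>\<^sup>+x. (\<integral>\<^sup>+y. indicator unit_cube x * indicator unit_cube y *
            ennreal (\<bar>u x - u y\<bar> * k (x - y)) \<partial>lborel) \<partial>lborel)"
    by (intro nn_integral_cong) (simp add: nn_integral_cmult[symmetric] nn_integral_multc[symmetric] ac_simps)
  also have "\<dots> = (\<integral>\<^sup>+x. (\<integral>\<^sup>+h. indicator unit_cube x * indicator unit_cube (x + h) *
            ennreal (\<bar>u x - u (x + h)\<bar> * k (x - (x + h))) \<partial>lborel) \<partial>lborel)"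
    by (intro nn_integral_cong nn_integral_lborel_translation[symmetric]) measurable
  also have "\<dots> = (\<integral>\<^sup>+x. (\<integral>\<^sup>+h. ennreal (k h) * (indicator unit_cube x * indicator unit_cube (x + h) *
            ennreal \<bar>u x - u (x + h)\<bar>) \<partial>lborel) \<partial>lborel)"
    using k by (intro nn_integral_cong) (simp add: even ennreal_mult ac_simps)
  also have "\<dots> = (\<integral>\<^sup>+h. (\<integral>\<^sup>+x. ennreal (k h) * (indicator unit_cube x * indicator unit_cube (x + h) *
            ennreal \<bar>u x - u (x + h)\<bar>) \<partial>lborel) \<partial>lborel)"
    by (rule lborel_pair.Fubini') measurable
  also have "\<dots> = (\<integral>\<^sup>+h. ennreal (k h) * increment_norm u h \<partial>lborel)"
    unfolding increment_norm_def by (intro nn_integral_cong nn_integral_cmult) measurable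
  finally show ?thesis .
qed

lemma increment_norm_0 [simp]: "increment_norm u 0 = 0"
  unfolding increment_norm_def by simp

lemma increment_norm_eq_0:
  fixes h :: "real^'n"
  assumes "norm h > real CARD('n)"
  shows "increment_norm u h = 0"
proof -
  have "x \<notin> unit_cube \<or> x + h \<notin> unit_cube" for x
    using norm_diff_unit_cube[of "x + h" x] assms by auto
  then have *: "indicator unit_cube x * indicator unit_cube (x + h) * ennreal \<bar>u x - u (x + h)\<bar> = 0" for x
    by (auto simp: indicator_def)
  show ?thesis
    unfolding increment_norm_def * by simp
qed

text \<open>Triangle inequality along \<open>N\<close> equal steps from \<open>x\<close> to
  \<open>x + h\<close>. Convexity keeps the intermediate points in the cube, and translation
  invariance makes every step contribute at most the same amount.\<close>

lemma increment_norm_chain: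
  fixes h :: "real^'n"
  assumes [measurable]: "u \<in> borel_measurable borel" and "N > 0"
  shows "increment_norm u h \<le> of_nat N * increment_norm u (h /\<^sub>R real N)"
proof -
  \<comment> \<open>The offset reached after \<open>j\<close> of the \<open>N\<close> steps.\<close>
  define p where "p j = (real j / real N) *\<^sub>R h" for j
  let ?Q = "unit_cube :: (real^'n) set"
  have p_Suc: "p (Suc j) = p j + h /\<^sub>R real N" for j
    unfolding p_def by (simp add: add_divide_distrib scaleR_add_left inverse_eq_divide)
  have pw: "indicator ?Q x * indicator ?Q (x + h) * ennreal \<bar>u x - u (x + h)\<bar>
      \<le> (\<Sum>j<N. indicator ?Q (p j + x) * indicator ?Q ((p j + x) + h /\<^sub>R real N) *
             ennreal \<bar>u (p j + x) - u ((p j + x) + h /\<^sub>R real N)\<bar>)" for x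
  proof (cases "x \<in> ?Q \<and> x + h \<in> ?Q")
    case True
    have mem: "p j + x \<in> ?Q" if "j \<le> N" for j
    proof -
      have "(1 - real j / real N) *\<^sub>R x + (real j / real N) *\<^sub>R (x + h) \<in> ?Q"
        by (rule convexD[OF convex_unit_cube]) (use True that \<open>N > 0\<close> in \<open>auto simp: field_simps\<close>)
      then show ?thesis by (simp add: p_def algebra_simps)
    qed
    have "u x - u (x + h) = (\<Sum>j<N. u (p j + x) - u (p (Suc j) + x))"
      using sum_lessThan_telescope'[of "\<lambda>j. u (p j + x)" N] \<open>N > 0\<close> by (simp add: p_def add.commute)
    then have "\<bar>u x - u (x + h)\<bar> \<le> (\<Sum>j<N. \<bar>u (p j + x) - u (p (Suc j) + x)\<bar>)"
      by (simp add: sum_abs)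
    then have "ennreal \<bar>u x - u (x + h)\<bar> \<le> (\<Sum>j<N. ennreal \<bar>u (p j + x) - u (p (Suc j) + x)\<bar>)"
      by (simp add: sum_ennreal)
    also have "\<dots> = (\<Sum>j<N. indicator ?Q (p j + x) * indicator ?Q ((p j + x) + h /\<^sub>R real N) *
             ennreal \<bar>u (p j + x) - u ((p j + x) + h /\<^sub>R real N)\<bar>)"
    proof (rule sum.cong[OF refl])
      fix j assume "j \<in> {..<N}"
      have eq: "(p j + x) + h /\<^sub>R real N = p (Suc j) + x" by (simp add: p_Suc)
      show "ennreal \<bar>u (p j + x) - u (p (Suc j) + x)\<bar> =
          indicator ?Q (p j + x) * indicator ?Q ((p j + x) + h /\<^sub>R real N) *
             ennreal \<bar>u (p j + x) - u ((p j + x) + h /\<^sub>R real N)\<bar>"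
        unfolding eq using mem[of j] mem[of "Suc j"] \<open>j \<in> {..<N}\<close> by simp
    qed
    finally show ?thesis using True by simp
  qed (auto simp: indicator_def)
  have "increment_norm u h \<le> (\<integral>\<^sup>+x. (\<Sum>j<N. indicator ?Q (p j + x) * indicator ?Q ((p j + x) + h /\<^sub>R real N) *
             ennreal \<bar>u (p j + x) - u ((p j + x) + h /\<^sub>R real N)\<bar>) \<partial>lborel)"
    unfolding increment_norm_def by (rule nn_integral_mono) (rule pw)
  also have "\<dots> = (\<Sum>j<N. \<integral>\<^sup>+x. indicator ?Q (p j + x) * indicator ?Q ((p j + x) + h /\<^sub>R real N) *
             ennreal \<bar>u (p j + x) - u ((p j + x) + h /\<^sub>R real N)\<bar> \<partial>lborel)"
    by (rule nn_integral_sum) measurable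
  also have "\<dots> = (\<Sum>j<N. increment_norm u (h /\<^sub>R real N))"
    unfolding increment_norm_def
    by (intro sum.cong refl nn_integral_lborel_translation[where f = "\<lambda>x. indicator ?Q x *
       indicator ?Q (x + h /\<^sub>R real N) * ennreal \<bar>u x - u (x + h /\<^sub>R real N)\<bar>"]) measurable
  finally show ?thesis by simp
qed

text \<open>Cutting \<open>h\<close> into \<open>N\<close> steps brings it into a ball on which the
  kernel is bounded below; rescaling the integral over \<open>h\<close> back costs only a constant.
  The constant is chosen before \<open>u\<close>.\<close>

lemma fractional_Poincare:
  assumes "0 < \<alpha>" "0 < \<delta>"
  obtains C where "C > 0"
    "\<And>u :: real^'n \<Rightarrow> real. u \<in> borel_measurable borel \<Longrightarrow>
       (\<integral>\<^sup>+x\<in>unit_cube. (\<integral>\<^sup>+y\<in>unit_cube. ennreal \<bar>u x - u y\<bar> \<partial>lborel) \<partial>lborel) \<le> ennreal C * frac_seminorm \<alpha> \<delta> u"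
proof -
  let ?n = "CARD('n)"
  \<comment> \<open>Any two points of the cube are at most \<open>CARD('n)\<close> apart, so this
    many steps are each shorter than \<delta>.\<close>
  obtain N :: nat where N: "real ?n / \<delta> < real N" using reals_Archimedean2 by blast
  have "0 < real ?n / \<delta>" using \<open>\<delta> > 0\<close> by simp
  then have N0: "N > 0" using N by (cases N) auto
  define d where "d = real ?n / real N"
  have d: "0 < d" "d < \<delta>" using N N0 \<open>\<delta> > 0\<close> by (auto simp: d_def field_simps)
  \<comment> \<open>The reciprocal of the least value of the kernel on the punctured ball of radius
    \<open>d\<close>.\<close>
  define c where "c = d powr (real ?n + \<alpha>)"
  have c: "c > 0" using d by (simp add: c_def)
  \<comment> \<open>One factor \<open>real N\<close> is the number of steps, the power is the
    Jacobian of the rescaling of \<open>h\<close>, and \<open>c\<close> compares with the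
    kernel.\<close>
  define C where "C = real N * real N ^ ?n * c"
  show thesis
  proof (rule that)
    show "C > 0" using c N0 by (simp add: C_def)
    fix u :: "real^'n \<Rightarrow> real"
    assume u[measurable]: "u \<in> borel_measurable borel"
    let ?P = "increment_norm u"
    have le: "indicator {h. norm h \<le> d} h * ?P h \<le> ennreal c * (ennreal (frac_kernel \<alpha> \<delta> h) * ?P h)" for h
    proof (cases "h \<noteq> 0 \<and> norm h \<le> d")
      case True
      then have "d powr (- (real ?n + \<alpha>)) \<le> frac_kernel \<alpha> \<delta> h"
        using d \<open>0 < \<alpha>\<close> by (intro frac_kernel_ge) auto
      then have "c * d powr (- (real ?n + \<alpha>)) \<le> c * frac_kernel \<alpha> \<delta> h"
        using c by (intro mult_left_mono) auto
      moreover have "c * d powr (- (real ?n + \<alpha>)) = 1"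
        using d unfolding c_def powr_add[symmetric] by simp
      ultimately have "1 \<le> c * frac_kernel \<alpha> \<delta> h" by simp
      then have "ennreal 1 \<le> ennreal (c * frac_kernel \<alpha> \<delta> h)" by (rule ennreal_leI)
      then have "1 * ?P h \<le> ennreal (c * frac_kernel \<alpha> \<delta> h) * ?P h"
        by (intro mult_right_mono) auto
      then show ?thesis using True c by (simp add: ennreal_mult ac_simps)
    qed auto
    have "(\<integral>\<^sup>+h. indicator {h. norm h \<le> d} h * ?P h \<partial>lborel)
        \<le> (\<integral>\<^sup>+h. ennreal c * (ennreal (frac_kernel \<alpha> \<delta> h) * ?P h) \<partial>lborel)"
      by (intro nn_integral_mono le)
    also have "\<dots> = ennreal c * (\<integral>\<^sup>+h. ennreal (frac_kernel \<alpha> \<delta> h) * ?P h \<partial>lborel)"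
      by (rule nn_integral_cmult) measurable
    also have "(\<integral>\<^sup>+h. ennreal (frac_kernel \<alpha> \<delta> h) * ?P h \<partial>lborel) = frac_seminorm \<alpha> \<delta> u"
      unfolding frac_seminorm_def by (rule double_integral_increments[symmetric]) auto
    finally have near: "(\<integral>\<^sup>+h. indicator {h. norm h \<le> d} h * ?P h \<partial>lborel) \<le> ennreal c * frac_seminorm \<alpha> \<delta> u" .
    have "(\<integral>\<^sup>+x\<in>unit_cube. (\<integral>\<^sup>+y\<in>unit_cube. ennreal \<bar>u x - u y\<bar> \<partial>lborel) \<partial>lborel) = (\<integral>\<^sup>+h. ?P h \<partial>lborel)"
      using double_integral_increments[of u "\<lambda>_. 1"] by simp
    also have "\<dots> \<le> (\<integral>\<^sup>+h. of_nat N * (indicator {h. norm h \<le> d} (h /\<^sub>R real N) * ?P (h /\<^sub>R real N)) \<partial>lborel)"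
    proof (rule nn_integral_mono)
      fix h :: "real^'n"
      show "?P h \<le> of_nat N * (indicator {h. norm h \<le> d} (h /\<^sub>R real N) * ?P (h /\<^sub>R real N))"
      proof (cases "norm h \<le> real ?n")
        case True
        then show ?thesis using increment_norm_chain[OF u N0, of h] N0
          by (simp add: d_def field_simps)
      qed (simp add: increment_norm_eq_0)
    qed
    also have "\<dots> = of_nat N * (\<integral>\<^sup>+h. indicator {h. norm h \<le> d} (h /\<^sub>R real N) * ?P (h /\<^sub>R real N) \<partial>lborel)"
      by (rule nn_integral_cmult) measurable
    also have "(\<integral>\<^sup>+h. indicator {h. norm h \<le> d} (h /\<^sub>R real N) * ?P (h /\<^sub>R real N) \<partial>lborel)
        = ennreal (real N ^ ?n) * (\<integral>\<^sup>+h. indicator {h. norm h \<le> d} h * ?P h \<partial>lborel)"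
      using N0 by (subst nn_integral_lborel_scaling[where f = "\<lambda>h. indicator {h. norm h \<le> d} h * ?P h"]) auto
    also have "of_nat N * (ennreal (real N ^ ?n) * (\<integral>\<^sup>+h. indicator {h. norm h \<le> d} h * ?P h \<partial>lborel))
        \<le> of_nat N * (ennreal (real N ^ ?n) * (ennreal c * frac_seminorm \<alpha> \<delta> u))"
      by (intro mult_left_mono near) auto
    finally show "(\<integral>\<^sup>+x\<in>unit_cube. (\<integral>\<^sup>+y\<in>unit_cube. ennreal \<bar>u x - u y\<bar> \<partial>lborel) \<partial>lborel)
        \<le> ennreal C * frac_seminorm \<alpha> \<delta> u"
      using c by (simp add: C_def ennreal_mult ennreal_of_nat_eq_real_of_nat ac_simps)
  qed
qed

subsection \<open>The Sobolev inequality\<close>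

text \<open>The image of the cube under the homothety with centre \<open>x\<close> and ratio
  \<open>r\<close>. It contains \<open>x\<close> and stays inside by convexity, so points near the
  boundary are treated like all others.\<close>

lemma subcube_of_unit_cube:
  fixes x :: "real^'n"
  assumes "x \<in> unit_cube" "0 < r" "r < 1"
  obtains B where "B \<in> sets borel" "B \<subseteq> unit_cube" "emeasure lborel B = ennreal (r ^ CARD('n))"
    "\<And>y. y \<in> B \<Longrightarrow> norm (x - y) \<le> real CARD('n) * r"
proof
  let ?a = "(1 - r) *\<^sub>R x"
  let ?B = "box ?a (?a + r *\<^sub>R One)"
  have mem: "y \<in> ?B \<longleftrightarrow> (\<forall>i. (1 - r) * x $ i < y $ i \<and> y $ i < (1 - r) * x $ i + r)" for y
    by (simp only: mem_box_cart vector_add_component vector_scaleR_component One_cart mult_1_right real_scaleR_def)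
  have x: "0 < x $ i" "x $ i < 1" for i using assms(1) by (auto simp: mem_unit_cube)
  show "?B \<in> sets borel" by simp
  show "?B \<subseteq> unit_cube"
  proof
    fix y assume "y \<in> ?B"
    then have y: "(1 - r) * x $ i < y $ i" "y $ i < (1 - r) * x $ i + r" for i by (auto simp only: mem)
    have "0 < y $ i \<and> y $ i < 1" for i
    proof -
      have "0 \<le> (1 - r) * x $ i" "(1 - r) * x $ i \<le> 1 - r"
        using x[of i] assms by (auto intro!: mult_left_le)
      then show ?thesis using y(1)[of i] y(2)[of i] by (intro conjI) linarith+
    qed
    then show "y \<in> unit_cube" by (simp add: mem_unit_cube)
  qed
  show "emeasure lborel ?B = ennreal (r ^ CARD('n))"
    using assms by (subst emeasure_lborel_box) (auto simp: inner_simps)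
  fix y assume "y \<in> ?B"
  then have y: "(1 - r) * x $ i < y $ i" "y $ i < (1 - r) * x $ i + r" for i by (auto simp only: mem)
  show "norm (x - y) \<le> real CARD('n) * r"
  proof (rule norm_le_card_mult)
    fix i
    have "0 < r * x $ i" "r * x $ i < r"
      using x[of i] assms by auto
    moreover have "(1 - r) * x $ i = x $ i - r * x $ i" by (simp add: algebra_simps)
    ultimately show "\<bar>(x - y) $ i\<bar> \<le> r"
      using y[of i] unfolding vector_minus_component by linarith
  qed
qed

text \<open>The left side is the lower bound for the singular integral in
  \<open>sobolev_pointwise\<close>: measure of the good set, times increment, times kernel.
  Logarithms make both sides linear, and \<open>q * (\<alpha> / n) = q - 1\<close> then matches the
  exponents of \<open>a\<close> and \<open>S\<close>.\<close>

lemma sobolev_exponent_identity: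
  fixes n \<alpha> q a S \<tau> r :: real
  assumes "0 < \<alpha>" "\<alpha> < n" "q = n / (n - \<alpha>)" "0 < a" "0 < S"
    and \<tau>: "\<tau> = S * (2 / a) powr q" and r: "r = (2 * \<tau>) powr (1 / n)"
  shows "\<tau> * (a / 2) * (n * r) powr (- (n + \<alpha>))
       = n powr (- (n + \<alpha>)) * 2 powr (- (1 + \<alpha> / n + q)) * (S powr (- (\<alpha> / n)) * a powr q)"
    (is "?L = ?R")
proof -
  have n: "n > 0" using assms by linarith
  have \<tau>0: "\<tau> > 0" using assms by simp
  have r0: "r > 0" using \<tau>0 r by simp
  have q: "q * (\<alpha> / n) = q - 1" using assms n by (simp add: field_simps)
  have lt: "ln \<tau> = ln S + q * (ln 2 - ln a)"
    unfolding \<tau> using assms by (simp add: ln_mult ln_powr ln_div)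
  have lr: "ln r = (1 / n) * (ln 2 + ln \<tau>)"
    unfolding r using \<tau>0 by (simp add: ln_powr ln_mult)
  have *: "(n + \<alpha>) * ((1 / n) * (ln 2 + ln \<tau>)) = (1 + \<alpha> / n) * (ln 2 + ln \<tau>)"
    using n by (simp add: field_simps)
  have **: "(\<alpha> / n) * ln \<tau> = (\<alpha> / n) * ln S + (q - 1) * (ln 2 - ln a)"
    unfolding lt q[symmetric] by (simp add: algebra_simps)
  have "ln ?L = ln \<tau> + (ln a - ln 2) - (n + \<alpha>) * (ln n + ln r)"
    using assms(4,5) n \<tau>0 r0 by (simp add: ln_mult ln_powr ln_div algebra_simps)
  also have "\<dots> = ln a - ln 2 - (n + \<alpha>) * ln n - (1 + \<alpha> / n) * ln 2 - (\<alpha> / n) * ln \<tau>"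
    using * unfolding lr by (simp add: algebra_simps)
  also have "\<dots> = - (n + \<alpha>) * ln n - (1 + \<alpha> / n + q) * ln 2 - (\<alpha> / n) * ln S + q * ln a"
    unfolding ** by (simp add: algebra_simps)
  also have "\<dots> = ln ?R"
    using assms(4,5) n \<tau>0 r0 by (simp add: ln_mult ln_powr algebra_simps)
  finally show ?thesis using assms(4,5) n \<tau>0 r0 by (subst (asm) ln_inj_iff) auto
qed

text \<open>The first summand is the reciprocal of the constant in
  \<open>sobolev_exponent_identity\<close>; the second comes from the points whose subcube would be
  too large.\<close>

definition sobolev_const :: "real \<Rightarrow> real \<Rightarrow> real \<Rightarrow> real" where
  "sobolev_const n \<alpha> \<delta> = n powr (n + \<alpha>) * 2 powr (1 + \<alpha> / n + n / (n - \<alpha>)) +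
     (2 powr (n / (n - \<alpha>) + 1) * (min (1/2) (\<delta> / (2 * n))) powr (- n)) powr (\<alpha> / n)"

text \<open>The form is made for integration in \<open>x\<close>: the bracket becomes the seminorm
  plus the L^1 norm, and the power of \<open>S\<close> on the right is smaller than 1, so that it
  can be divided out.\<close>

lemma sobolev_pointwise:
  fixes u :: "real^'n \<Rightarrow> real" and \<alpha> \<delta> S :: real
  defines "n \<equiv> real CARD('n)"
  defines "q \<equiv> n / (n - \<alpha>)"
  assumes [measurable]: "u \<in> borel_measurable borel"
    and \<alpha>: "0 < \<alpha>" "\<alpha> < n" and "0 < \<delta>"
    and S: "(\<integral>\<^sup>+y\<in>unit_cube. ennreal (\<bar>u y\<bar> powr q) \<partial>lborel) = ennreal S" "0 < S"
    and x: "x \<in> unit_cube"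
  shows "ennreal (\<bar>u x\<bar> powr q) \<le> ennreal (sobolev_const n \<alpha> \<delta> * S powr (\<alpha> / n)) *
     ((\<integral>\<^sup>+y\<in>unit_cube. ennreal (\<bar>u x - u y\<bar> * frac_kernel \<alpha> \<delta> (x - y)) \<partial>lborel) + ennreal \<bar>u x\<bar>)"
proof (cases "u x = 0")
  case False
  define a where "a = \<bar>u x\<bar>"
  have a: "a > 0" using False by (simp add: a_def)
  have n: "n > 0" using \<alpha> by linarith
  have q: "q > 1" using \<alpha> by (simp add: q_def)
  have q1: "q * (\<alpha> / n) = q - 1" using \<alpha> n by (simp add: q_def field_simps)
  \<comment> \<open>Largest admissible side: below 1, so that the subcube exists, and such that
    distances up to \<open>n * r0\<close> stay below the truncation radius \<delta>.\<close>
  define r0 where "r0 = min (1/2) (\<delta> / (2 * n))"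
  have r0: "0 < r0" "r0 < 1" "n * r0 < \<delta>"
  proof -
    have "n * r0 \<le> n * (\<delta> / (2 * n))" unfolding r0_def using n by (intro mult_left_mono) auto
    then show "n * r0 < \<delta>" using n \<open>0 < \<delta>\<close> by simp
  qed (use n \<open>0 < \<delta>\<close> in \<open>auto simp: r0_def\<close>)
  \<comment> \<open>Chebyshev's bound for the measure of the points of the cube where
    \<open>u\<close> is at least \<open>a / 2\<close> in absolute value.\<close>
  define \<tau> where "\<tau> = S * (2 / a) powr q"
  have \<tau>: "\<tau> > 0" using S a by (simp add: \<tau>_def)
  define D where "D = (\<integral>\<^sup>+y\<in>unit_cube. ennreal (\<bar>u x - u y\<bar> * frac_kernel \<alpha> \<delta> (x - y)) \<partial>lborel)"
  define c1 where "c1 = n powr (- (n + \<alpha>)) * 2 powr (- (1 + \<alpha> / n + q))"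
  define C2 where "C2 = (2 powr (q + 1) * r0 powr (- n)) powr (\<alpha> / n)"
  have c1: "c1 > 0" using n by (simp add: c1_def)
  have C2: "C2 \<ge> 0" by (simp add: C2_def)
  have const: "sobolev_const n \<alpha> \<delta> = 1 / c1 + C2"
    unfolding sobolev_const_def c1_def C2_def q_def[symmetric] r0_def[symmetric] powr_minus
    using n by (simp add: field_simps)
  show ?thesis
  proof (cases "2 * \<tau> \<le> r0 powr n")
    case True
    define r where "r = (2 * \<tau>) powr (1 / n)"
    have r: "0 < r" "r \<le> r0"
    proof -
      have "r \<le> (r0 powr n) powr (1 / n)"
        unfolding r_def using True \<tau> n by (intro powr_mono2) auto
      then show "r \<le> r0" using n r0 by (simp add: powr_powr)
    qed (use \<tau> in \<open>auto simp: r_def\<close>)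
    have rn: "r ^ CARD('n) = 2 * \<tau>"
    proof -
      have "r ^ CARD('n) = r powr n" using r by (simp add: n_def powr_realpow)
      then show ?thesis using \<tau> n by (simp add: r_def powr_powr)
    qed
    have r1: "r < 1" using r r0 by linarith
    obtain B where B[measurable]: "B \<in> sets borel" and Bsub: "B \<subseteq> unit_cube"
      and Bm': "emeasure lborel B = ennreal (r ^ CARD('n))"
      and Bd: "\<And>y. y \<in> B \<Longrightarrow> norm (x - y) \<le> real CARD('n) * r"
      by (rule subcube_of_unit_cube[OF x r(1) r1]) blast
    have Bm: "emeasure lborel B = ennreal (2 * \<tau>)" using Bm' unfolding rn .
    \<comment> \<open>The set where \<open>\<bar>u y\<bar>\<close> is at least \<open>a / 2\<close>,
      phrased so that the Markov inequality applies literally.\<close>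
    define G where "G = {y \<in> unit_cube. 1 \<le> ennreal ((2 / a) powr q) * ennreal (\<bar>u y\<bar> powr q)}"
    have G[measurable]: "G \<in> sets borel" unfolding G_def by measurable
    have "emeasure lborel G \<le> ennreal ((2 / a) powr q) * (\<integral>\<^sup>+y\<in>unit_cube. ennreal (\<bar>u y\<bar> powr q) \<partial>lborel)"
      unfolding G_def by (rule nn_integral_Markov_inequality) measurable
    also have "\<dots> = ennreal \<tau>" unfolding S using S(2) by (simp add: \<tau>_def ennreal_mult[symmetric] mult.commute)
    finally have Gm: "emeasure lborel G \<le> ennreal \<tau>" .
    have small: "\<bar>u y\<bar> < a / 2" if "y \<in> unit_cube" "y \<notin> G" for y
    proof (rule ccontr)
      assume "\<not> \<bar>u y\<bar> < a / 2"
      then have "1 \<le> (2 / a) * \<bar>u y\<bar>" using a by (simp add: field_simps)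
      then have "1 \<le> ((2 / a) * \<bar>u y\<bar>) powr q" using q by (intro ge_one_powr_ge_zero) auto
      then have "1 \<le> (2 / a) powr q * \<bar>u y\<bar> powr q" using a by (simp add: powr_mult powr_divide)
      then have "ennreal 1 \<le> ennreal ((2 / a) powr q * \<bar>u y\<bar> powr q)" by (rule ennreal_leI)
      then have "y \<in> G" using that by (simp add: G_def ennreal_mult)
      with that show False by simp
    qed
    have "ennreal (2 * \<tau>) \<le> emeasure lborel ((B - G) \<union> G)"
      unfolding Bm[symmetric] by (intro emeasure_mono) auto
    also have "\<dots> \<le> emeasure lborel (B - G) + emeasure lborel G"
      by (intro emeasure_subadditive) auto
    also have "\<dots> \<le> emeasure lborel (B - G) + ennreal \<tau>"
      by (intro add_left_mono Gm)
    finally have "ennreal \<tau> + ennreal \<tau> \<le> ennreal \<tau> + emeasure lborel (B - G)"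
      using \<tau> by (simp add: ennreal_plus[symmetric] add.commute)
    then have BG: "ennreal \<tau> \<le> emeasure lborel (B - G)"
      by (simp add: ennreal_add_left_cancel_le)
    \<comment> \<open>On \<open>B - G\<close> the increment of \<open>u\<close> is at least
      \<open>a / 2\<close> and the distance to \<open>x\<close> at most \<open>n * r\<close>, so
      \<open>e\<close> bounds the integrand from below.\<close>
    define e where "e = (a / 2) * (n * r) powr (- (n + \<alpha>))"
    have e: "e \<ge> 0" using a by (simp add: e_def)
    have "ennreal (\<tau> * e) \<le> ennreal e * emeasure lborel (B - G)"
      using mult_left_mono[OF BG, of "ennreal e"] e \<tau> by (simp add: ennreal_mult mult.commute)
    also have "\<dots> = (\<integral>\<^sup>+y. ennreal e * indicator (B - G) y \<partial>lborel)"
      by (simp add: nn_integral_cmult_indicator)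
    also have "\<dots> \<le> D"
      unfolding D_def
    proof (rule nn_integral_mono)
      fix y
      show "ennreal e * indicator (B - G) y
         \<le> ennreal (\<bar>u x - u y\<bar> * frac_kernel \<alpha> \<delta> (x - y)) * indicator unit_cube y"
      proof (cases "y \<in> B - G")
        case True
        then have y: "y \<in> unit_cube" using Bsub by auto
        have uy: "\<bar>u y\<bar> < a / 2" using small[OF y] True by auto
        have d: "a / 2 \<le> \<bar>u x - u y\<bar>" using uy unfolding a_def by linarith
        have "x \<noteq> y" using d a by auto
        then have "(n * r) powr (- (n + \<alpha>)) \<le> frac_kernel \<alpha> \<delta> (x - y)"
          unfolding n_def
        proof (intro frac_kernel_ge)
          show "norm (x - y) \<le> real CARD('n) * r" using Bd[of y] True by (simp add: n_def)
          have "n * r \<le> n * r0" using r n by simp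
          then show "real CARD('n) * r < \<delta>" using r0(3) unfolding n_def by linarith
        qed (use \<alpha> in auto)
        then have "e \<le> \<bar>u x - u y\<bar> * frac_kernel \<alpha> \<delta> (x - y)"
          unfolding e_def using d a by (intro mult_mono) auto
        then show ?thesis using True y by (simp add: ennreal_leI)
      qed auto
    qed
    finally have "ennreal (\<tau> * e) \<le> D" .
    moreover have "\<tau> * e = c1 * (S powr (- (\<alpha> / n)) * a powr q)"
      using sobolev_exponent_identity[OF \<alpha> q_def[unfolded atomize_eq] a S(2) \<tau>_def r_def]
      by (simp add: e_def c1_def mult.assoc)
    moreover have "a powr q = (1 / c1 * S powr (\<alpha> / n)) * (c1 * (S powr (- (\<alpha> / n)) * a powr q))"
      using c1 S(2) by (simp add: powr_minus field_simps)
    ultimately have "ennreal (a powr q) \<le> ennreal (1 / c1 * S powr (\<alpha> / n)) * D"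
      using c1 by (metis ennreal_mult' mult_left_mono zero_le divide_nonneg_pos mult_nonneg_nonneg powr_ge_zero zero_le_one)
    also have "\<dots> \<le> ennreal (sobolev_const n \<alpha> \<delta> * S powr (\<alpha> / n)) * (D + ennreal a)"
      using C2 unfolding const by (intro mult_mono ennreal_leI mult_right_mono) auto
    finally show ?thesis unfolding D_def a_def .
  next
    case False
    \<comment> \<open>Here \<tau> is large, so \<open>a powr q\<close> is at most a constant times
      \<open>S\<close>. Raising this to the power \<open>\<alpha> / n\<close> bounds
      \<open>a powr (q - 1)\<close>, and one more factor \<open>a\<close> gives the term with
      \<open>\<bar>u x\<bar>\<close>.\<close>
    have "\<tau> * a powr q = S * 2 powr q" using a by (simp add: \<tau>_def powr_divide)
    moreover have "r0 powr n * a powr q < (2 * \<tau>) * a powr q"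
      using False a by (intro mult_strict_right_mono) auto
    ultimately have "r0 powr n * a powr q < 2 * (S * 2 powr q)" by simp
    then have "a powr q \<le> 2 powr (q + 1) * r0 powr (- n) * S"
      using r0 by (simp add: powr_add powr_minus field_simps)
    then have "(a powr q) powr (\<alpha> / n) \<le> (2 powr (q + 1) * r0 powr (- n) * S) powr (\<alpha> / n)"
      using \<alpha> n by (intro powr_mono2) auto
    also have "(a powr q) powr (\<alpha> / n) = a powr (q - 1)" by (simp only: powr_powr q1)
    also have "(2 powr (q + 1) * r0 powr (- n) * S) powr (\<alpha> / n) = C2 * S powr (\<alpha> / n)"
      using S by (simp add: C2_def powr_mult)
    finally have "a powr (q - 1) * a \<le> C2 * S powr (\<alpha> / n) * a" using a by simp
    moreover have "a powr (q - 1) * a = a powr q" using a by (simp add: powr_diff)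
    ultimately have "ennreal (a powr q) \<le> ennreal (C2 * S powr (\<alpha> / n)) * ennreal a"
      using C2 a by (simp add: ennreal_mult[symmetric] ennreal_leI)
    also have "\<dots> \<le> ennreal (sobolev_const n \<alpha> \<delta> * S powr (\<alpha> / n)) * (D + ennreal a)"
      using c1 unfolding const by (intro mult_mono ennreal_leI mult_right_mono) auto
    finally show ?thesis unfolding D_def a_def .
  qed
qed simp

lemma sobolev_const_pos:
  assumes "0 < \<alpha>" "\<alpha> < n" "0 < \<delta>"
  shows "0 < sobolev_const n \<alpha> \<delta>"
  using assms unfolding sobolev_const_def by (intro add_pos_nonneg mult_pos_pos) auto

text \<open>Boundedness makes \<open>S\<close> finite. Integrating \<open>sobolev_pointwise\<close>
  gives \<open>S \<le> c * S powr (\<alpha> / n) * T\<close> with \<open>c\<close> the Sobolev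
  constant, and cancelling the power of \<open>S\<close> leaves the exponent
  \<open>1 / q\<close>.\<close>

lemma sobolev_bounded:
  fixes u :: "real^'n \<Rightarrow> real" and \<alpha> \<delta> T :: real
  defines "n \<equiv> real CARD('n)"
  defines "q \<equiv> n / (n - \<alpha>)"
  assumes [measurable]: "u \<in> borel_measurable borel"
    and bdd: "\<And>x. \<bar>u x\<bar> \<le> M"
    and \<alpha>: "0 < \<alpha>" "\<alpha> < n" and "0 < \<delta>" "0 \<le> T"
    and T: "frac_seminorm \<alpha> \<delta> u + (\<integral>\<^sup>+x\<in>unit_cube. ennreal \<bar>u x\<bar> \<partial>lborel) \<le> ennreal T"
  shows "(\<integral>\<^sup>+x\<in>unit_cube. ennreal (\<bar>u x\<bar> powr q) \<partial>lborel) \<le> ennreal ((sobolev_const n \<alpha> \<delta> * T) powr q)"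
proof -
  have n: "n > 0" using \<alpha> by linarith
  have q: "q > 1" using \<alpha> by (simp add: q_def)
  have q1: "(1 - \<alpha> / n) * q = 1" using \<alpha> n by (simp add: q_def field_simps)
  let ?I = "\<integral>\<^sup>+x\<in>unit_cube. ennreal (\<bar>u x\<bar> powr q) \<partial>lborel"
  let ?C = "sobolev_const n \<alpha> \<delta>"
  have C: "?C > 0" using \<alpha> \<open>0 < \<delta>\<close> by (rule sobolev_const_pos)
  have "?I \<le> (\<integral>\<^sup>+x. ennreal (M powr q) * indicator unit_cube x \<partial>(lborel :: (real^'n) measure))"
    using bdd q by (intro nn_integral_mono mult_right_mono ennreal_leI powr_mono2) auto
  also have "\<dots> = ennreal (M powr q)"
    by (subst nn_integral_cmult_indicator) (auto simp: emeasure_unit_cube)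
  finally have "?I < top" by (rule le_less_trans) simp
  then obtain S where S: "?I = ennreal S" "0 \<le> S" by (cases ?I) auto
  show ?thesis
  proof (cases "S = 0")
    case False
    then have S0: "S > 0" using S by simp
    let ?c = "?C * S powr (\<alpha> / n)"
    let ?D = "\<lambda>x. \<integral>\<^sup>+y\<in>unit_cube. ennreal (\<bar>u x - u y\<bar> * frac_kernel \<alpha> \<delta> (x - y)) \<partial>lborel"
    have "?I \<le> (\<integral>\<^sup>+x\<in>unit_cube. ennreal ?c * (?D x + ennreal \<bar>u x\<bar>) \<partial>lborel)"
    proof (rule nn_integral_mono)
      fix x :: "real^'n"
      show "ennreal (\<bar>u x\<bar> powr q) * indicator unit_cube x \<le> ennreal ?c * (?D x + ennreal \<bar>u x\<bar>) * indicator unit_cube x"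
      proof (cases "x \<in> unit_cube")
        case True
        from sobolev_pointwise[OF _ \<alpha>(1) \<alpha>(2)[unfolded n_def] \<open>0 < \<delta>\<close> S(1)[unfolded q_def n_def] S0 True]
        show ?thesis using True by (simp add: n_def q_def)
      qed simp
    qed
    also have "\<dots> = (\<integral>\<^sup>+x. ennreal ?c * (?D x * indicator unit_cube x + ennreal \<bar>u x\<bar> * indicator unit_cube x) \<partial>lborel)"
      by (intro nn_integral_cong) (simp add: distrib_right mult.assoc)
    also have "\<dots> = ennreal ?c * (frac_seminorm \<alpha> \<delta> u + (\<integral>\<^sup>+x\<in>unit_cube. ennreal \<bar>u x\<bar> \<partial>lborel))"
      unfolding frac_seminorm_def by (subst nn_integral_cmult, measurable, subst nn_integral_add, measurable)
    also have "\<dots> \<le> ennreal ?c * ennreal T"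
      by (intro mult_left_mono T) auto
    also have "\<dots> = ennreal (?c * T)"
      using C \<open>0 \<le> T\<close> by (intro ennreal_mult[symmetric]) auto
    finally have "S \<le> ?C * S powr (\<alpha> / n) * T"
      unfolding S using C \<open>0 \<le> T\<close> by (subst (asm) ennreal_le_iff) auto
    moreover have "S = S powr (\<alpha> / n) * S powr (1 - \<alpha> / n)"
      using S0 by (simp flip: powr_add)
    ultimately have "S powr (\<alpha> / n) * S powr (1 - \<alpha> / n) \<le> S powr (\<alpha> / n) * (?C * T)"
      by (simp add: ac_simps)
    then have "S powr (1 - \<alpha> / n) \<le> ?C * T"
      using S0 by simp
    then have "(S powr (1 - \<alpha> / n)) powr q \<le> (?C * T) powr q"
      using q by (intro powr_mono2) auto
    then have "S \<le> (?C * T) powr q" using S0 by (simp add: powr_powr q1)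
    then show ?thesis unfolding S by (rule ennreal_leI)
  qed (simp add: S)
qed

lemma frac_seminorm_mono:
  assumes "\<And>x y. \<bar>v x - v y\<bar> \<le> \<bar>u x - u y\<bar>"
  shows "frac_seminorm \<alpha> \<delta> v \<le> frac_seminorm \<alpha> \<delta> u"
  unfolding frac_seminorm_def
  by (intro nn_integral_mono mult_right_mono ennreal_leI assms) auto

text \<open>Truncation at height \<open>k\<close> is 1-Lipschitz and fixes 0, so it increases
  neither the seminorm nor the L^1 norm. The bound for the truncations is uniform in
  \<open>k\<close> and passes to \<open>u\<close> by Fatou's lemma.\<close>

lemma sobolev:
  fixes u :: "real^'n \<Rightarrow> real" and \<alpha> \<delta> T :: real
  defines "n \<equiv> real CARD('n)"
  defines "q \<equiv> n / (n - \<alpha>)"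
  assumes u[measurable]: "u \<in> borel_measurable borel"
    and \<alpha>: "0 < \<alpha>" "\<alpha> < n" and "0 < \<delta>" "0 \<le> T"
    and T: "frac_seminorm \<alpha> \<delta> u + (\<integral>\<^sup>+x\<in>unit_cube. ennreal \<bar>u x\<bar> \<partial>lborel) \<le> ennreal T"
  shows "(\<integral>\<^sup>+x\<in>unit_cube. ennreal (\<bar>u x\<bar> powr q) \<partial>lborel) \<le> ennreal ((sobolev_const n \<alpha> \<delta> * T) powr q)"
proof -
  define v where "v k x = max (- real k) (min (real k) (u x))" for k x
  have v[measurable]: "v k \<in> borel_measurable borel" for k
    unfolding v_def[abs_def] by measurable
  have bound: "(\<integral>\<^sup>+x\<in>unit_cube. ennreal (\<bar>v k x\<bar> powr q) \<partial>lborel) \<le> ennreal ((sobolev_const n \<alpha> \<delta> * T) powr q)" for k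
    unfolding n_def q_def
  proof (rule sobolev_bounded)
    show "\<bar>v k x\<bar> \<le> real k" for x unfolding v_def by auto
    have "frac_seminorm \<alpha> \<delta> (v k) + (\<integral>\<^sup>+x\<in>unit_cube. ennreal \<bar>v k x\<bar> \<partial>lborel)
        \<le> frac_seminorm \<alpha> \<delta> u + (\<integral>\<^sup>+x\<in>unit_cube. ennreal \<bar>u x\<bar> \<partial>lborel)"
    proof (intro add_mono frac_seminorm_mono nn_integral_mono mult_right_mono ennreal_leI)
      show "\<bar>v k x - v k y\<bar> \<le> \<bar>u x - u y\<bar>" for x y unfolding v_def by (auto simp: max_def min_def)
      show "\<bar>v k x\<bar> \<le> \<bar>u x\<bar>" for x unfolding v_def by (auto simp: max_def min_def)
    qed auto
    also note T
    finally show "frac_seminorm \<alpha> \<delta> (v k) + (\<integral>\<^sup>+x\<in>unit_cube. ennreal \<bar>v k x\<bar> \<partial>lborel) \<le> ennreal T" .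
  qed (use \<alpha> \<open>0 < \<delta>\<close> \<open>0 \<le> T\<close> in \<open>auto simp: n_def\<close>)
  have lim: "liminf (\<lambda>k. ennreal (\<bar>v k x\<bar> powr q) * indicator unit_cube x) = ennreal (\<bar>u x\<bar> powr q) * indicator unit_cube x" for x
  proof (rule lim_imp_Liminf[OF _ tendsto_eventually])
    obtain k0 where k0: "\<bar>u x\<bar> \<le> real k0" using real_arch_simple by blast
    show "\<forall>\<^sub>F k in sequentially. ennreal (\<bar>v k x\<bar> powr q) * indicator unit_cube x = ennreal (\<bar>u x\<bar> powr q) * indicator unit_cube x"
      using eventually_ge_at_top[of k0]
    proof eventually_elim
      case (elim k)
      then have "real k0 \<le> real k" by simp
      then have "v k x = u x" using k0 unfolding v_def by linarith
      then show ?case by simp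
    qed
  qed simp
  have "(\<integral>\<^sup>+x\<in>unit_cube. ennreal (\<bar>u x\<bar> powr q) \<partial>lborel)
      = (\<integral>\<^sup>+x. liminf (\<lambda>k. ennreal (\<bar>v k x\<bar> powr q) * indicator unit_cube x) \<partial>lborel)"
    unfolding lim ..
  also have "\<dots> \<le> liminf (\<lambda>k. \<integral>\<^sup>+x\<in>unit_cube. ennreal (\<bar>v k x\<bar> powr q) \<partial>lborel)"
    by (rule nn_integral_liminf) measurable
  also have "\<dots> \<le> limsup (\<lambda>k. \<integral>\<^sup>+x\<in>unit_cube. ennreal (\<bar>v k x\<bar> powr q) \<partial>lborel)"
    by (rule Liminf_le_Limsup) simp
  also have "\<dots> \<le> ennreal ((sobolev_const n \<alpha> \<delta> * T) powr q)"
    by (rule Limsup_bounded) (use bound in auto)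
  finally show ?thesis .
qed

section \<open>Control of the L^1 norm by oscillation and mean, and the combined Sobolev-Poincare
  inequality\<close>

text \<open>For each \<open>x\<close>, \<open>m * u x\<close> is the integral over \<open>c\<close>
  of \<open>u x - u y\<close> plus that of \<open>u\<close>; take absolute values and integrate in
  \<open>x\<close>. It is used for the whole cube and for the cells of a grid.\<close>

lemma cell_oscillation:
  fixes u :: "'a::euclidean_space \<Rightarrow> real"
  assumes [measurable]: "u \<in> borel_measurable borel" "c \<in> sets borel"
    and m: "emeasure lborel c = ennreal m" "0 \<le> m"
    and int: "set_integrable lborel c u"
  shows "ennreal m * (\<integral>\<^sup>+x\<in>c. ennreal \<bar>u x\<bar> \<partial>lborel) \<le>
      (\<integral>\<^sup>+x\<in>c. (\<integral>\<^sup>+y\<in>c. ennreal \<bar>u x - u y\<bar> \<partial>lborel) \<partial>lborel) + ennreal (m * \<bar>LINT y:c|lborel. u y\<bar>)"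
proof -
  let ?I = "LINT y:c|lborel. u y"
  have pw: "ennreal m * ennreal \<bar>u x\<bar> \<le> (\<integral>\<^sup>+y\<in>c. ennreal \<bar>u x - u y\<bar> \<partial>lborel) + ennreal \<bar>?I\<bar>" for x
  proof -
    have ci: "set_integrable lborel c (\<lambda>y. u x)"
      using m by (auto simp: set_integrable_def intro!: integrable_scaleR_left integrable_real_indicator)
    have di: "set_integrable lborel c (\<lambda>y. u x - u y)"
      by (rule set_integral_diff(1)[OF ci int])
    have "(LINT y:c|lborel. u x) = m * u x"
      using m by (simp add: set_lebesgue_integral_def measure_def)
    then have "m * u x = (LINT y:c|lborel. u x - u y) + ?I"
      using set_integral_diff(2)[OF ci int] by simp
    then have "\<bar>m * u x\<bar> \<le> \<bar>LINT y:c|lborel. u x - u y\<bar> + \<bar>?I\<bar>" by (simp add: abs_triangle_ineq)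
    then have "ennreal \<bar>m * u x\<bar> \<le> ennreal \<bar>LINT y:c|lborel. u x - u y\<bar> + ennreal \<bar>?I\<bar>"
      by (simp flip: ennreal_plus)
    also have "ennreal \<bar>LINT y:c|lborel. u x - u y\<bar> \<le> (\<integral>\<^sup>+y. ennreal (norm (indicator c y *\<^sub>R (u x - u y))) \<partial>lborel)"
      using integral_norm_bound_ennreal[OF di[unfolded set_integrable_def]] by (simp add: set_lebesgue_integral_def)
    also have "\<dots> = (\<integral>\<^sup>+y\<in>c. ennreal \<bar>u x - u y\<bar> \<partial>lborel)"
      by (intro nn_integral_cong) (auto simp: indicator_def)
    finally show ?thesis using m by (simp add: abs_mult ennreal_mult)
  qed
  have "ennreal m * (\<integral>\<^sup>+x\<in>c. ennreal \<bar>u x\<bar> \<partial>lborel) = (\<integral>\<^sup>+x\<in>c. ennreal m * ennreal \<bar>u x\<bar> \<partial>lborel)"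
    by (simp add: nn_integral_cmult[symmetric] mult.assoc)
  also have "\<dots> \<le> (\<integral>\<^sup>+x\<in>c. ((\<integral>\<^sup>+y\<in>c. ennreal \<bar>u x - u y\<bar> \<partial>lborel) + ennreal \<bar>?I\<bar>) \<partial>lborel)"
    by (intro nn_integral_mono mult_right_mono pw) auto
  also have "\<dots> = (\<integral>\<^sup>+x\<in>c. (\<integral>\<^sup>+y\<in>c. ennreal \<bar>u x - u y\<bar> \<partial>lborel) \<partial>lborel) + (\<integral>\<^sup>+x. ennreal \<bar>?I\<bar> * indicator c x \<partial>lborel)"
    by (subst nn_integral_add[symmetric]) (auto simp: distrib_right)
  also have "(\<integral>\<^sup>+x. ennreal \<bar>?I\<bar> * indicator c x \<partial>lborel) = ennreal (m * \<bar>?I\<bar>)"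
    using m by (subst nn_integral_cmult_indicator) (auto simp: ennreal_mult mult.commute)
  finally show ?thesis .
qed

text \<open>With mean zero, \<open>cell_oscillation\<close> on the cube and
  \<open>fractional_Poincare\<close> bound the L^1 norm by \<open>P * j\<close>, after which
  \<open>sobolev\<close> applies with \<open>T = (1 + P) * j\<close>. A single constant serves both
  estimates and is independent of \<open>u\<close>.\<close>

lemma sobolev_Poincare:
  fixes \<alpha> \<delta> :: real
  assumes \<alpha>: "0 < \<alpha>" "\<alpha> < real CARD('n)" and "0 < \<delta>"
  obtains C where "C > 0"
    "\<And>(u :: real^'n \<Rightarrow> real) j. u \<in> borel_measurable borel \<Longrightarrow> set_integrable lborel unit_cube u \<Longrightarrow>
       (LINT x:unit_cube|lborel. u x) = 0 \<Longrightarrow> 0 \<le> j \<Longrightarrow> frac_seminorm \<alpha> \<delta> u \<le> ennreal j \<Longrightarrow>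
       (\<integral>\<^sup>+x\<in>unit_cube. ennreal \<bar>u x\<bar> \<partial>lborel) \<le> ennreal (C * j) \<and>
       (\<integral>\<^sup>+x\<in>unit_cube. ennreal (\<bar>u x\<bar> powr (real CARD('n) / (real CARD('n) - \<alpha>))) \<partial>lborel)
         \<le> ennreal ((C * j) powr (real CARD('n) / (real CARD('n) - \<alpha>)))"
proof -
  let ?n = "real CARD('n)"
  let ?q = "?n / (?n - \<alpha>)"
  obtain P where P: "P > 0" "\<And>u :: real^'n \<Rightarrow> real. u \<in> borel_measurable borel \<Longrightarrow>
       (\<integral>\<^sup>+x\<in>unit_cube. (\<integral>\<^sup>+y\<in>unit_cube. ennreal \<bar>u x - u y\<bar> \<partial>lborel) \<partial>lborel) \<le> ennreal P * frac_seminorm \<alpha> \<delta> u"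
    using fractional_Poincare[OF \<alpha>(1) \<open>0 < \<delta>\<close>] by blast
  define A where "A = sobolev_const ?n \<alpha> \<delta>"
  have A: "A > 0" unfolding A_def using \<alpha> \<open>0 < \<delta>\<close> by (rule sobolev_const_pos)
  define C where "C = P + A * (1 + P)"
  have C: "C > 0" "P \<le> C" "A * (1 + P) \<le> C" using P A by (auto simp: C_def intro!: add_pos_pos)
  have q: "?q \<ge> 0" using \<alpha> by simp
  show thesis
  proof (rule that[OF C(1)])
    fix u :: "real^'n \<Rightarrow> real" and j :: real
    assume u[measurable]: "u \<in> borel_measurable borel" and int: "set_integrable lborel unit_cube u"
      and mean: "(LINT x:unit_cube|lborel. u x) = 0" and j: "0 \<le> j" "frac_seminorm \<alpha> \<delta> u \<le> ennreal j"
    have "(\<integral>\<^sup>+x\<in>unit_cube. ennreal \<bar>u x\<bar> \<partial>lborel) \<le> (\<integral>\<^sup>+x\<in>unit_cube. (\<integral>\<^sup>+y\<in>unit_cube. ennreal \<bar>u x - u y\<bar> \<partial>lborel) \<partial>lborel)"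
      using cell_oscillation[OF u unit_cube_borel _ _ int, of 1] mean by (simp add: emeasure_unit_cube)
    also have "\<dots> \<le> ennreal P * frac_seminorm \<alpha> \<delta> u" by (rule P) simp
    also have "\<dots> \<le> ennreal P * ennreal j" by (intro mult_left_mono j) auto
    also have "\<dots> = ennreal (P * j)" using P j by (simp add: ennreal_mult)
    finally have L1: "(\<integral>\<^sup>+x\<in>unit_cube. ennreal \<bar>u x\<bar> \<partial>lborel) \<le> ennreal (P * j)" .
    have "frac_seminorm \<alpha> \<delta> u + (\<integral>\<^sup>+x\<in>unit_cube. ennreal \<bar>u x\<bar> \<partial>lborel) \<le> ennreal j + ennreal (P * j)"
      by (intro add_mono L1 j)
    also have "\<dots> = ennreal ((1 + P) * j)" using j P by (simp add: ennreal_plus[symmetric] algebra_simps del: ennreal_plus)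
    finally have T: "frac_seminorm \<alpha> \<delta> u + (\<integral>\<^sup>+x\<in>unit_cube. ennreal \<bar>u x\<bar> \<partial>lborel) \<le> ennreal ((1 + P) * j)" .
    have "(\<integral>\<^sup>+x\<in>unit_cube. ennreal (\<bar>u x\<bar> powr ?q) \<partial>lborel) \<le> ennreal ((A * ((1 + P) * j)) powr ?q)"
      unfolding A_def using P j by (intro sobolev[OF u \<alpha> \<open>0 < \<delta>\<close> _ T]) auto
    also have "\<dots> \<le> ennreal ((C * j) powr ?q)"
      using C(3) j P A q unfolding mult.assoc[symmetric] by (intro ennreal_leI powr_mono2 mult_right_mono) auto
    finally have Lq: "(\<integral>\<^sup>+x\<in>unit_cube. ennreal (\<bar>u x\<bar> powr ?q) \<partial>lborel) \<le> ennreal ((C * j) powr ?q)" .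
    have "ennreal (P * j) \<le> ennreal (C * j)" using C j by (intro ennreal_leI mult_right_mono) auto
    with L1 Lq show "(\<integral>\<^sup>+x\<in>unit_cube. ennreal \<bar>u x\<bar> \<partial>lborel) \<le> ennreal (C * j) \<and>
       (\<integral>\<^sup>+x\<in>unit_cube. ennreal (\<bar>u x\<bar> powr ?q) \<partial>lborel) \<le> ennreal ((C * j) powr ?q)"
      using order_trans by blast
  qed
qed

subsection \<open>Compactness\<close>

definition grid_index :: "nat \<Rightarrow> ('n \<Rightarrow> int) set" where
  "grid_index m = {a. \<forall>i. a i \<in> {0..<int m}}"

text \<open>Floors instead of boxes make the cells an exact partition of the cube, so integrals
  split without exceptional null sets.\<close>

definition grid_cell :: "nat \<Rightarrow> ('n \<Rightarrow> int) \<Rightarrow> (real^'n) set" where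
  "grid_cell m a = {x \<in> unit_cube. \<forall>i. \<lfloor>real m * x $ i\<rfloor> = a i}"

lemma finite_grid_index: "finite (grid_index m :: ('n::finite \<Rightarrow> int) set)"
proof -
  have "grid_index m = (Pi\<^sub>E UNIV (\<lambda>_. {0..<int m}) :: ('n \<Rightarrow> int) set)"
    by (auto simp: grid_index_def PiE_def)
  then show ?thesis by (simp add: finite_PiE)
qed

lemma grid_cell_borel [measurable]: "grid_cell m a \<in> sets borel"
  unfolding grid_cell_def by measurable

lemma grid_cell_subset: "grid_cell m a \<subseteq> unit_cube"
  by (auto simp: grid_cell_def)

lemma sum_indicator_grid_cell:
  fixes x :: "real^'n"
  assumes "m > 0"
  shows "(\<Sum>a\<in>grid_index m. indicator (grid_cell m a) x) = (indicator unit_cube x :: ennreal)"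
proof (cases "x \<in> unit_cube")
  case True
  define b :: "'n \<Rightarrow> int" where "b i = \<lfloor>real m * x $ i\<rfloor>" for i
  have "0 \<le> b i \<and> b i < int m" for i
  proof -
    have "0 < x $ i" "x $ i < 1" using True by (auto simp: mem_unit_cube)
    then have "0 \<le> real m * x $ i" "real m * x $ i < real m" using assms by auto
    then show ?thesis unfolding b_def by (auto simp: floor_less_iff)
  qed
  then have b: "b \<in> grid_index m" by (auto simp: grid_index_def)
  have "indicator (grid_cell m a) x = (if a = b then 1 else 0 :: ennreal)" for a
    using True by (cases "a = b") (auto simp: grid_cell_def indicator_def b_def fun_eq_iff, metis)
  then show ?thesis using True b by (simp add: sum.delta[OF finite_grid_index])
qed (auto simp: grid_cell_def)

text \<open>The cell contains an open box of side \<open>1 / m\<close> and lies in the cube, which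
  gives the lower bound and finiteness.\<close>

lemma emeasure_grid_cell:
  fixes a :: "'n::finite \<Rightarrow> int"
  assumes "m > 0" "a \<in> grid_index m"
  obtains \<mu> where "emeasure lborel (grid_cell m a) = ennreal \<mu>" "(1 / real m) ^ CARD('n) \<le> \<mu>"
proof -
  let ?l = "(\<chi> i. real_of_int (a i) / real m) :: real^'n"
  let ?B = "box ?l (?l + (1 / real m) *\<^sub>R One)"
  have a: "0 \<le> a i" "a i < int m" for i using assms(2) by (auto simp: grid_index_def)
  have mem: "y \<in> ?B \<longleftrightarrow> (\<forall>i. real_of_int (a i) / real m < y $ i \<and> y $ i < real_of_int (a i) / real m + 1 / real m)" for y
    by (simp only: mem_box_cart vector_add_component vector_scaleR_component One_cart mult_1_right real_scaleR_def vec_lambda_beta)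
  have "?B \<subseteq> grid_cell m a"
  proof
    fix y assume "y \<in> ?B"
    then have y: "real_of_int (a i) < real m * y $ i" "real m * y $ i < real_of_int (a i) + 1" for i
      using assms(1) unfolding mem by (auto simp: field_simps)
    have "0 < y $ i \<and> y $ i < 1" for i
    proof -
      have "0 \<le> real_of_int (a i)" "real_of_int (a i) + 1 \<le> real m" using a[of i] by linarith+
      then have "0 < real m * y $ i" "real m * y $ i < real m * 1" using y[of i] by linarith+
      then show ?thesis using assms(1) by (simp add: zero_less_mult_iff)
    qed
    moreover have "\<lfloor>real m * y $ i\<rfloor> = a i" for i
      using y[of i] by (intro floor_unique) auto
    ultimately show "y \<in> grid_cell m a" by (auto simp: grid_cell_def mem_unit_cube)
  qed
  then have "emeasure lborel ?B \<le> emeasure lborel (grid_cell m a)"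
    by (intro emeasure_mono) auto
  moreover have "emeasure lborel ?B = ennreal ((1 / real m) ^ CARD('n))"
    using assms(1) by (subst emeasure_lborel_box) (auto simp: inner_simps)
  moreover have "emeasure lborel (grid_cell m a) \<le> 1"
    unfolding emeasure_unit_cube[symmetric, where 'n = 'n] by (intro emeasure_mono grid_cell_subset) auto
  ultimately show thesis
    using that[of "enn2real (emeasure lborel (grid_cell m a))"]
    by (cases "emeasure lborel (grid_cell m a)") (auto simp: top_unique)
qed

lemma grid_cell_diameter:
  fixes x y :: "real^'n"
  assumes "m > 0" "x \<in> grid_cell m a" "y \<in> grid_cell m a"
  shows "norm (x - y) \<le> real CARD('n) / real m"
proof -
  have "\<bar>(x - y) $ i\<bar> \<le> 1 / real m" for i
  proof -
    have "\<lfloor>real m * x $ i\<rfloor> = \<lfloor>real m * y $ i\<rfloor>" using assms by (auto simp: grid_cell_def)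
    then have "\<bar>real m * x $ i - real m * y $ i\<bar> \<le> 1" by linarith
    then have "real m * \<bar>x $ i - y $ i\<bar> \<le> 1"
      using assms(1) by (simp add: abs_mult right_diff_distrib[symmetric])
    then show ?thesis using assms(1) by (simp add: field_simps)
  qed
  from norm_le_card_mult[OF this] show ?thesis by simp
qed

text \<open>On one cell the inverse of the kernel's lower bound is
  \<open>(n / m) powr (n + \<alpha>)\<close>, and dividing \<open>cell_oscillation\<close> by the
  volume costs at most \<open>m powr n\<close>. The product decays like
  \<open>m powr (- \<alpha>)\<close>; summing over the partition recovers the full seminorm.\<close>

lemma grid_estimate:
  fixes u :: "real^'n \<Rightarrow> real"
  assumes u[measurable]: "u \<in> borel_measurable borel" and int: "set_integrable lborel unit_cube u"
    and "0 < \<alpha>" "m > 0" "real CARD('n) / real m < \<delta>"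
  shows "(\<integral>\<^sup>+x\<in>unit_cube. ennreal \<bar>u x\<bar> \<partial>lborel) \<le>
    ennreal (real CARD('n) powr (real CARD('n) + \<alpha>) * real m powr (- \<alpha>)) * frac_seminorm \<alpha> \<delta> u
    + (\<Sum>a\<in>grid_index m. ennreal \<bar>LINT x:grid_cell m a|lborel. u x\<bar>)"
proof -
  let ?n = "real CARD('n)"
  let ?d = "?n / real m"
  define K where "K = ?n powr (?n + \<alpha>) * real m powr (- \<alpha>)"
  let ?F = "\<lambda>x y. ennreal (\<bar>u x - u y\<bar> * frac_kernel \<alpha> \<delta> (x - y))"
  let ?Q = "unit_cube :: (real^'n) set"
  have cell: "(\<integral>\<^sup>+x\<in>grid_cell m a. ennreal \<bar>u x\<bar> \<partial>lborel)
      \<le> ennreal K * (\<integral>\<^sup>+x\<in>grid_cell m a. (\<integral>\<^sup>+y\<in>?Q. ?F x y \<partial>lborel) \<partial>lborel)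
        + ennreal \<bar>LINT x:grid_cell m a|lborel. u x\<bar>"
    if a: "a \<in> grid_index m" for a
  proof -
    let ?c = "grid_cell m a"
    let ?I = "\<bar>LINT x:?c|lborel. u x\<bar>"
    let ?O = "\<integral>\<^sup>+x\<in>?c. (\<integral>\<^sup>+y\<in>?c. ennreal \<bar>u x - u y\<bar> \<partial>lborel) \<partial>lborel"
    let ?N = "\<integral>\<^sup>+x\<in>?c. ennreal \<bar>u x\<bar> \<partial>lborel"
    let ?G = "\<integral>\<^sup>+x\<in>?c. (\<integral>\<^sup>+y\<in>?Q. ?F x y \<partial>lborel) \<partial>lborel"
    obtain \<mu> where \<mu>: "emeasure lborel ?c = ennreal \<mu>" "(1 / real m) ^ CARD('n) \<le> \<mu>"
      by (rule emeasure_grid_cell[OF \<open>m > 0\<close> a])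
    have "0 < (1 / real m) ^ CARD('n)" using \<open>m > 0\<close> by simp
    then have \<mu>0: "\<mu> > 0" using \<mu>(2) by linarith
    have int': "set_integrable lborel ?c u"
      by (rule set_integrable_subset[OF int]) (auto simp: grid_cell_subset)
    have inv: "?d powr (?n + \<alpha>) / \<mu> \<le> K"
    proof -
      have "1 / \<mu> \<le> real m powr ?n"
        using \<mu>(2) \<mu>0 \<open>m > 0\<close> by (simp add: field_simps powr_realpow)
      then have "?d powr (?n + \<alpha>) * (1 / \<mu>) \<le> ?d powr (?n + \<alpha>) * real m powr ?n"
        by (intro mult_left_mono) auto
      also have "\<dots> = K"
        using \<open>m > 0\<close> by (simp add: K_def powr_divide powr_add powr_minus field_simps)
      finally show ?thesis by simp
    qed
    have "?O \<le> (\<integral>\<^sup>+x\<in>?c. ennreal (?d powr (?n + \<alpha>)) * (\<integral>\<^sup>+y\<in>?Q. ?F x y \<partial>lborel) \<partial>lborel)"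
    proof (rule nn_integral_mono)
      fix x
      show "(\<integral>\<^sup>+y\<in>?c. ennreal \<bar>u x - u y\<bar> \<partial>lborel) * indicator ?c x
         \<le> ennreal (?d powr (?n + \<alpha>)) * (\<integral>\<^sup>+y\<in>?Q. ?F x y \<partial>lborel) * indicator ?c x"
      proof (cases "x \<in> ?c")
        case True
        have "(\<integral>\<^sup>+y\<in>?c. ennreal \<bar>u x - u y\<bar> \<partial>lborel)
            \<le> (\<integral>\<^sup>+y. ennreal (?d powr (?n + \<alpha>)) * (?F x y * indicator ?Q y) \<partial>lborel)"
        proof (rule nn_integral_mono)
          fix y
          show "ennreal \<bar>u x - u y\<bar> * indicator ?c y
            \<le> ennreal (?d powr (?n + \<alpha>)) * (?F x y * indicator ?Q y)"
          proof (cases "y \<in> ?c \<and> x \<noteq> y")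
            case y: True
            have "?d powr (- (?n + \<alpha>)) \<le> frac_kernel \<alpha> \<delta> (x - y)"
              using y grid_cell_diameter[OF \<open>m > 0\<close> True, of y] assms by (intro frac_kernel_ge) auto
            then have "?d powr (?n + \<alpha>) * ?d powr (- (?n + \<alpha>)) \<le> ?d powr (?n + \<alpha>) * frac_kernel \<alpha> \<delta> (x - y)"
              by (intro mult_left_mono) auto
            moreover have "?d powr (?n + \<alpha>) * ?d powr (- (?n + \<alpha>)) = 1"
              using \<open>m > 0\<close> unfolding powr_add[symmetric] by simp
            ultimately have "\<bar>u x - u y\<bar> * 1 \<le> \<bar>u x - u y\<bar> * (?d powr (?n + \<alpha>) * frac_kernel \<alpha> \<delta> (x - y))"
              by (intro mult_left_mono) auto
            then have "ennreal \<bar>u x - u y\<bar> \<le> ennreal (?d powr (?n + \<alpha>) * (\<bar>u x - u y\<bar> * frac_kernel \<alpha> \<delta> (x - y)))"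
              by (intro ennreal_leI) (simp add: ac_simps)
            then show ?thesis using y grid_cell_subset[of m a] by (auto simp: ennreal_mult)
          qed auto
        qed
        also have "\<dots> = ennreal (?d powr (?n + \<alpha>)) * (\<integral>\<^sup>+y\<in>?Q. ?F x y \<partial>lborel)"
          by (rule nn_integral_cmult) measurable
        finally show ?thesis using True by simp
      qed simp
    qed
    also have "\<dots> = ennreal (?d powr (?n + \<alpha>)) * ?G"
      unfolding mult.assoc by (rule nn_integral_cmult) measurable
    finally have O: "?O \<le> ennreal (?d powr (?n + \<alpha>)) * ?G" .
    \<comment> \<open>Dividing by the positive volume \<mu> of the cell, written as a product in
      \<open>ennreal\<close>.\<close>
    have "?N = ennreal (1 / \<mu>) * (ennreal \<mu> * ?N)"
      using \<mu>0 by (simp add: mult.assoc[symmetric] ennreal_mult[symmetric])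
    also have "\<dots> \<le> ennreal (1 / \<mu>) * (ennreal (?d powr (?n + \<alpha>)) * ?G + ennreal (\<mu> * ?I))"
    proof (intro mult_left_mono)
      have "ennreal \<mu> * ?N \<le> ?O + ennreal (\<mu> * ?I)"
        using \<mu>0 by (intro cell_oscillation \<mu> int') auto
      also have "\<dots> \<le> ennreal (?d powr (?n + \<alpha>)) * ?G + ennreal (\<mu> * ?I)"
        by (intro add_right_mono O)
      finally show "ennreal \<mu> * ?N \<le> ennreal (?d powr (?n + \<alpha>)) * ?G + ennreal (\<mu> * ?I)" .
    qed simp
    also have "\<dots> = ennreal (?d powr (?n + \<alpha>) / \<mu>) * ?G + ennreal ?I"
      using \<mu>0 by (simp add: distrib_left mult.assoc[symmetric] ennreal_mult[symmetric])
    also have "\<dots> \<le> ennreal K * ?G + ennreal ?I"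
      by (intro add_right_mono mult_right_mono ennreal_leI inv) auto
    finally show ?thesis .
  qed
  have "(\<integral>\<^sup>+x\<in>?Q. ennreal \<bar>u x\<bar> \<partial>lborel)
      = (\<integral>\<^sup>+x. (\<Sum>a\<in>grid_index m. ennreal \<bar>u x\<bar> * indicator (grid_cell m a) x) \<partial>lborel)"
    unfolding sum_distrib_left[symmetric] sum_indicator_grid_cell[OF \<open>m > 0\<close>] ..
  also have "\<dots> = (\<Sum>a\<in>grid_index m. \<integral>\<^sup>+x\<in>grid_cell m a. ennreal \<bar>u x\<bar> \<partial>lborel)"
    by (rule nn_integral_sum) measurable
  also have "\<dots> \<le> (\<Sum>a\<in>grid_index m. ennreal K * (\<integral>\<^sup>+x\<in>grid_cell m a. (\<integral>\<^sup>+y\<in>?Q. ?F x y \<partial>lborel) \<partial>lborel)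
        + ennreal \<bar>LINT x:grid_cell m a|lborel. u x\<bar>)"
    by (intro sum_mono cell)
  also have "\<dots> = ennreal K * (\<Sum>a\<in>grid_index m. \<integral>\<^sup>+x\<in>grid_cell m a. (\<integral>\<^sup>+y\<in>?Q. ?F x y \<partial>lborel) \<partial>lborel)
        + (\<Sum>a\<in>grid_index m. ennreal \<bar>LINT x:grid_cell m a|lborel. u x\<bar>)"
    by (simp add: sum.distrib sum_distrib_left)
  also have "(\<Sum>a\<in>grid_index m. \<integral>\<^sup>+x\<in>grid_cell m a. (\<integral>\<^sup>+y\<in>?Q. ?F x y \<partial>lborel) \<partial>lborel)
      = (\<integral>\<^sup>+x. (\<Sum>a\<in>grid_index m. (\<integral>\<^sup>+y\<in>?Q. ?F x y \<partial>lborel) * indicator (grid_cell m a) x) \<partial>lborel)"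
    by (rule nn_integral_sum[symmetric]) measurable
  also have "\<dots> = frac_seminorm \<alpha> \<delta> u"
    unfolding sum_distrib_left[symmetric] sum_indicator_grid_cell[OF \<open>m > 0\<close>] frac_seminorm_def ..
  finally show ?thesis unfolding K_def .
qed

lemma frac_seminorm_diff:
  assumes [measurable]: "u \<in> borel_measurable borel" "v \<in> borel_measurable borel"
  shows "frac_seminorm \<alpha> \<delta> (\<lambda>x. u x - v x) \<le> frac_seminorm \<alpha> \<delta> u + frac_seminorm \<alpha> \<delta> v"
proof -
  let ?F = "\<lambda>u x y. ennreal (\<bar>u x - u y\<bar> * frac_kernel \<alpha> \<delta> (x - y))"
  have pw: "?F (\<lambda>x. u x - v x) x y \<le> ?F u x y + ?F v x y" for x y
  proof -
    have "\<bar>u x - v x - (u y - v y)\<bar> * frac_kernel \<alpha> \<delta> (x - y)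
       \<le> (\<bar>u x - u y\<bar> + \<bar>v x - v y\<bar>) * frac_kernel \<alpha> \<delta> (x - y)"
      by (intro mult_right_mono) auto
    then have "?F (\<lambda>x. u x - v x) x y \<le> ennreal (\<bar>u x - u y\<bar> * frac_kernel \<alpha> \<delta> (x - y) + \<bar>v x - v y\<bar> * frac_kernel \<alpha> \<delta> (x - y))"
      by (intro ennreal_leI) (simp add: distrib_right)
    then show ?thesis by (simp add: ennreal_plus)
  qed
  have "frac_seminorm \<alpha> \<delta> (\<lambda>x. u x - v x) \<le>
    (\<integral>\<^sup>+x\<in>unit_cube. (\<integral>\<^sup>+y\<in>unit_cube. (?F u x y + ?F v x y) \<partial>lborel) \<partial>lborel)"
    unfolding frac_seminorm_def by (intro nn_integral_mono mult_right_mono pw) auto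
  also have "\<dots> = frac_seminorm \<alpha> \<delta> u + frac_seminorm \<alpha> \<delta> v"
    unfolding frac_seminorm_def by (simp add: distrib_right nn_integral_add)
  finally show ?thesis .
qed

text \<open>Along a suitable subsequence all cell integrals converge; \<open>grid_estimate\<close>
  applied to differences then makes the sequence Cauchy in L^1.\<close>

lemma frac_seminorm_compact:
  fixes u :: "nat \<Rightarrow> real^'n \<Rightarrow> real"
  assumes u[measurable]: "\<And>k. u k \<in> borel_measurable borel"
    and int: "\<And>k. set_integrable lborel unit_cube (u k)"
    and "0 < \<alpha>" "0 < \<delta>" "0 \<le> J"
    and J: "\<And>k. frac_seminorm \<alpha> \<delta> (u k) \<le> ennreal J"
    and B: "\<And>k. (\<integral>\<^sup>+x\<in>unit_cube. ennreal \<bar>u k x\<bar> \<partial>lborel) \<le> ennreal B" "0 \<le> B"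
  obtains r :: "nat \<Rightarrow> nat" where "strict_mono r"
    "\<forall>e>0. \<exists>N. \<forall>k\<ge>N. \<forall>l\<ge>N.
       (\<integral>\<^sup>+x\<in>unit_cube. ennreal \<bar>u (r k) x - u (r l) x\<bar> \<partial>lborel) \<le> ennreal e"
proof -
  \<comment> \<open>The cell integrals of all meshes \<open>m\<close> at once, so that one
    subsequence serves every grid.\<close>
  define X where "X k = (\<lambda>(m, a). LINT x:grid_cell m a|lborel. u k x)" for k
  have intc: "set_integrable lborel (grid_cell m a) (u k)" for k m a
    by (rule set_integrable_subset[OF int]) (auto simp: grid_cell_subset)
  have X_bound: "\<bar>X k (m, a)\<bar> \<le> B" for k m a
  proof -
    have "ennreal \<bar>X k (m, a)\<bar> \<le> (\<integral>\<^sup>+x. ennreal (norm (indicator (grid_cell m a) x *\<^sub>R u k x)) \<partial>lborel)"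
      using integral_norm_bound_ennreal[OF intc[unfolded set_integrable_def]] by (simp add: X_def set_lebesgue_integral_def)
    also have "\<dots> \<le> (\<integral>\<^sup>+x\<in>unit_cube. ennreal \<bar>u k x\<bar> \<partial>lborel)"
      using grid_cell_subset[of m a] by (intro nn_integral_mono) (auto simp: indicator_def)
    also note B(1)
    finally show ?thesis using B(2) by simp
  qed
  \<comment> \<open>Tychonoff's theorem; as the index type is countable, the product is also
    sequentially compact, which replaces a diagonal argument.\<close>
  have "compact (Pi\<^sub>E UNIV (\<lambda>_. {-B..B}) :: (nat \<times> ('n \<Rightarrow> int) \<Rightarrow> real) set)"
    using compactin_PiE[of "\<lambda>_. euclidean" UNIV "\<lambda>_. {-B..B}"]
    by (simp add: euclidean_product_topology)
  then have "seq_compact (Pi\<^sub>E UNIV (\<lambda>_. {-B..B}) :: (nat \<times> ('n \<Rightarrow> int) \<Rightarrow> real) set)"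
    by (rule compact_imp_seq_compact)
  moreover have "X k \<in> Pi\<^sub>E UNIV (\<lambda>_. {-B..B})" for k
    using X_bound[of k] by (auto simp: abs_le_iff minus_le_iff)
  ultimately obtain L r where r: "strict_mono r" and L: "(X \<circ> r) \<longlonglongrightarrow> L"
    by (metis seq_compactE)
  have conv: "(\<lambda>k. X (r k) i) \<longlonglongrightarrow> L i" for i
    using continuous_on_tendsto_compose[OF continuous_on_product_coordinates[of i] L] by (simp add: o_def)
  show thesis
  proof (rule that[OF r], intro allI impI)
    fix e :: real assume e: "0 < e"
    define A where "A = real CARD('n) powr (real CARD('n) + \<alpha>)"
    \<comment> \<open>The mesh is fixed first: \<open>2 * J\<close> bounds the seminorm of every
      difference, so a large \<open>m\<close> makes the first term of \<open>grid_estimate\<close>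
      less than \<open>e / 2\<close>. Afterwards only finitely many cell integrals must be
      close.\<close>
    have "(\<lambda>m. A * real m powr (- \<alpha>) * (2 * J)) \<longlonglongrightarrow> A * 0 * (2 * J)"
      using \<open>0 < \<alpha>\<close> by (intro tendsto_mult tendsto_const tendsto_neg_powr filterlim_real_sequentially) auto
    then have "\<forall>\<^sub>F m in sequentially. A * real m powr (- \<alpha>) * (2 * J) < e / 2"
      using e by (intro order_tendstoD(2)) auto
    moreover have "(\<lambda>m. real CARD('n) / real m) \<longlonglongrightarrow> 0"
      by (rule lim_const_over_n)
    then have "\<forall>\<^sub>F m in sequentially. real CARD('n) / real m < \<delta>"
      using \<open>0 < \<delta>\<close> by (rule order_tendstoD(2))
    ultimately have "\<forall>\<^sub>F m in sequentially. A * real m powr (- \<alpha>) * (2 * J) < e / 2 \<and> real CARD('n) / real m < \<delta> \<and> m > 0"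
      using eventually_gt_at_top[of 0] by eventually_elim auto
    then obtain m where m: "A * real m powr (- \<alpha>) * (2 * J) < e / 2" "real CARD('n) / real m < \<delta>" "m > 0"
      by (auto simp: eventually_sequentially)
    have "(\<lambda>k. \<Sum>a\<in>grid_index m. \<bar>X (r k) (m, a) - L (m, a)\<bar>) \<longlonglongrightarrow> (\<Sum>a\<in>(grid_index m :: ('n \<Rightarrow> int) set). \<bar>L (m, a) - L (m, a)\<bar>)"
      by (intro tendsto_intros conv)
    then have "\<forall>\<^sub>F k in sequentially. (\<Sum>a\<in>grid_index m. \<bar>X (r k) (m, a) - L (m, a)\<bar>) < e / 4"
      using e by (intro order_tendstoD(2)) auto
    then obtain N where N: "\<And>k. k \<ge> N \<Longrightarrow> (\<Sum>a\<in>grid_index m. \<bar>X (r k) (m, a) - L (m, a)\<bar>) < e / 4"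
      by (auto simp: eventually_sequentially)
    have "(\<integral>\<^sup>+x\<in>unit_cube. ennreal \<bar>u (r k) x - u (r l) x\<bar> \<partial>lborel) \<le> ennreal e" if "k \<ge> N" "l \<ge> N" for k l
    proof -
      let ?w = "\<lambda>x. u (r k) x - u (r l) x"
      have "frac_seminorm \<alpha> \<delta> ?w \<le> ennreal J + ennreal J"
        by (rule order_trans[OF frac_seminorm_diff add_mono[OF J J]]) auto
      also have "\<dots> = ennreal (2 * J)" using \<open>0 \<le> J\<close> by (simp flip: ennreal_plus)
      finally have w: "frac_seminorm \<alpha> \<delta> ?w \<le> ennreal (2 * J)" .
      have wint: "set_integrable lborel unit_cube ?w" by (rule set_integral_diff(1)[OF int int])
      have X: "(LINT x:grid_cell m a|lborel. ?w x) = X (r k) (m, a) - X (r l) (m, a)" for a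
        unfolding X_def using set_integral_diff(2)[OF intc intc] by simp
      have "(\<Sum>a\<in>grid_index m. \<bar>X (r k) (m, a) - X (r l) (m, a)\<bar>)
          \<le> (\<Sum>a\<in>grid_index m. \<bar>X (r k) (m, a) - L (m, a)\<bar> + \<bar>X (r l) (m, a) - L (m, a)\<bar>)"
        by (intro sum_mono) linarith
      also have "\<dots> \<le> e / 2" using N[OF that(1)] N[OF that(2)] by (simp add: sum.distrib)
      finally have s: "(\<Sum>a\<in>grid_index m. \<bar>X (r k) (m, a) - X (r l) (m, a)\<bar>) \<le> e / 2" .
      have "(\<integral>\<^sup>+x\<in>unit_cube. ennreal \<bar>?w x\<bar> \<partial>lborel) \<le>
         ennreal (A * real m powr (- \<alpha>)) * frac_seminorm \<alpha> \<delta> ?w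
         + (\<Sum>a\<in>grid_index m. ennreal \<bar>LINT x:grid_cell m a|lborel. ?w x\<bar>)"
        unfolding A_def using \<open>0 < \<alpha>\<close> m wint by (intro grid_estimate) auto
      also have "\<dots> \<le> ennreal (A * real m powr (- \<alpha>)) * ennreal (2 * J) + ennreal (e / 2)"
        unfolding X using s by (intro add_mono mult_left_mono w) (auto simp: sum_ennreal intro!: ennreal_leI)
      also have "\<dots> = ennreal (A * real m powr (- \<alpha>) * (2 * J) + e / 2)"
        using \<open>0 \<le> J\<close> e by (simp add: ennreal_mult A_def)
      also have "\<dots> \<le> ennreal e" using m by (intro ennreal_leI) auto
      finally show ?thesis .
    qed
    then show "\<exists>N. \<forall>k\<ge>N. \<forall>l\<ge>N. (\<integral>\<^sup>+x\<in>unit_cube. ennreal \<bar>u (r k) x - u (r l) x\<bar> \<partial>lborel) \<le> ennreal e" by blast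
  qed
qed

text \<open>The Riesz-Fischer argument: along a subsequence consecutive L^1 distances are at most
  \<open>(1/2) ^ j\<close>, so the increments are absolutely summable almost everywhere. The
  majorant \<open>h\<close> is returned for later dominated convergence.\<close>

lemma L1_Cauchy_subsequence:
  fixes f :: "nat \<Rightarrow> 'a \<Rightarrow> real"
  assumes f: "\<And>k. integrable M (f k)"
    and Cauchy: "\<And>e. 0 < e \<Longrightarrow> \<exists>N. \<forall>k\<ge>N. \<forall>l\<ge>N. (\<integral>\<^sup>+x. ennreal \<bar>f k x - f l x\<bar> \<partial>M) \<le> ennreal e"
  obtains r :: "nat \<Rightarrow> nat" and h where "strict_mono r" "integrable M h"
    "AE x in M. convergent (\<lambda>k. f (r k) x)" "AE x in M. \<forall>k. \<bar>f (r k) x\<bar> \<le> h x"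
proof -
  have [measurable]: "f k \<in> borel_measurable M" for k using f by auto
  have "\<exists>N. \<forall>j. \<forall>k\<ge>N j. \<forall>l\<ge>N j. (\<integral>\<^sup>+x. ennreal \<bar>f k x - f l x\<bar> \<partial>M) \<le> ennreal ((1/2) ^ j)"
    using Cauchy by (intro choice allI) simp
  then obtain N where N: "\<And>j k l. k \<ge> N j \<Longrightarrow> l \<ge> N j \<Longrightarrow> (\<integral>\<^sup>+x. ennreal \<bar>f k x - f l x\<bar> \<partial>M) \<le> ennreal ((1/2) ^ j)"
    by blast
  \<comment> \<open>The maximum puts \<open>r j\<close> beyond \<open>N j\<close>, and
    \<open>Suc s\<close> makes \<open>r\<close> strictly increasing.\<close>
  define r where "r = rec_nat (N 0) (\<lambda>j s. max (N (Suc j)) (Suc s))"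
  have r_Suc: "r (Suc j) = max (N (Suc j)) (Suc (r j))" for j by (simp add: r_def)
  have r: "strict_mono r" by (rule strict_mono_Suc_iff[THEN iffD2]) (simp add: r_Suc less_max_iff_disj)
  have rN: "r j \<ge> N j" for j by (cases j) (simp_all add: r_def)
  define g where "g j x = f (r (Suc j)) x - f (r j) x" for j x
  have [measurable]: "g j \<in> borel_measurable M" for j unfolding g_def[abs_def] by measurable
  have gi: "integrable M (g j)" for j unfolding g_def[abs_def] by (intro Bochner_Integration.integrable_diff f)
  have gb: "(\<integral>\<^sup>+x. ennreal \<bar>g j x\<bar> \<partial>M) \<le> ennreal ((1/2) ^ j)" for j
    unfolding g_def by (intro N rN order_trans[OF rN]) (simp add: r_Suc)
  have gb': "(\<integral>x. \<bar>g j x\<bar> \<partial>M) \<le> (1/2) ^ j" for j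
    using gb[of j] gi[of j] by (subst (asm) nn_integral_eq_integral) auto
  have geo: "summable (\<lambda>j. (1/2 :: real) ^ j)" by (rule summable_geometric) simp
  have "(\<integral>\<^sup>+x. (\<Sum>j. ennreal \<bar>g j x\<bar>) \<partial>M) = (\<Sum>j. \<integral>\<^sup>+x. ennreal \<bar>g j x\<bar> \<partial>M)"
    by (rule nn_integral_suminf) measurable
  also have "\<dots> \<le> (\<Sum>j. ennreal ((1/2) ^ j))"
    by (intro suminf_le gb) auto
  also have "\<dots> < top" using geo by (simp add: suminf_ennreal2)
  finally have "AE x in M. (\<Sum>j. ennreal \<bar>g j x\<bar>) \<noteq> \<infinity>"
    by (intro nn_integral_PInf_AE) auto
  then have summ: "AE x in M. summable (\<lambda>j. \<bar>g j x\<bar>)"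
    by eventually_elim (rule summable_suminf_not_top, auto)
  have sumi: "summable (\<lambda>j. \<integral>x. \<bar>g j x\<bar> \<partial>M)"
    by (rule summable_comparison_test'[OF geo, of 0]) (use gb' in auto)
  define h where "h x = \<bar>f (r 0) x\<bar> + (\<Sum>j. \<bar>g j x\<bar>)" for x
  have tel: "f (r k) x = f (r 0) x + (\<Sum>j<k. g j x)" for k x
    using sum_lessThan_telescope[of "\<lambda>j. f (r j) x" k] by (simp add: g_def)
  show thesis
  proof (rule that[OF r])
    show "integrable M h"
      unfolding h_def using summ sumi gi f
      by (intro Bochner_Integration.integrable_add integrable_abs integrable_suminf) auto
    show "AE x in M. convergent (\<lambda>k. f (r k) x)"
      using summ
    proof eventually_elim
      case (elim x)
      then have "summable (\<lambda>j. g j x)" by (rule summable_rabs_cancel)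
      then have "(\<lambda>k. f (r 0) x + (\<Sum>j<k. g j x)) \<longlonglongrightarrow> f (r 0) x + (\<Sum>j. g j x)"
        by (intro tendsto_add tendsto_const summable_LIMSEQ)
      then show ?case unfolding tel[symmetric] by (auto simp: convergent_def)
    qed
    show "AE x in M. \<forall>k. \<bar>f (r k) x\<bar> \<le> h x"
      using summ
    proof eventually_elim
      case (elim x)
      show ?case
      proof
        fix k
        have "\<bar>f (r k) x\<bar> \<le> \<bar>f (r 0) x\<bar> + \<bar>\<Sum>j<k. g j x\<bar>" unfolding tel[of k] by (rule abs_triangle_ineq)
        also have "\<bar>\<Sum>j<k. g j x\<bar> \<le> (\<Sum>j<k. \<bar>g j x\<bar>)" by (rule sum_abs)
        also have "\<dots> \<le> (\<Sum>j. \<bar>g j x\<bar>)" by (rule sum_le_suminf[OF elim]) auto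
        finally show "\<bar>f (r k) x\<bar> \<le> h x" by (simp add: h_def)
      qed
    qed
  qed
qed

subsection \<open>Lebesgue measurable and periodic functions\<close>

lemma fst_snd_borel [measurable]:
  "fst \<in> borel_measurable (borel :: ('a::euclidean_space \<times> 'b::euclidean_space) measure)"
  "snd \<in> borel_measurable (borel :: ('a::euclidean_space \<times> 'b::euclidean_space) measure)"
  by (intro borel_measurable_continuous_onI continuous_intros)+

lemma unit_cube_lebesgue [measurable]: "unit_cube \<in> sets lebesgue"
  using unit_cube_borel by (intro sets_completionI_sets) simp

lemma AE_lborel_fst:
  assumes "AE x in (lborel :: 'a::euclidean_space measure). P x"
  shows "AE z in (lborel :: ('a \<times> 'b::euclidean_space) measure). P (fst z)"
proof -
  obtain N where N: "N \<in> null_sets lborel" "{x. \<not> P x} \<subseteq> N"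
    using assms by (auto simp: null_sets_def elim!: AE_E)
  then have "emeasure (lborel \<Otimes>\<^sub>M lborel) (N \<times> (UNIV :: 'b set)) = 0"
    by (subst lborel.emeasure_pair_measure_Times) auto
  moreover have "N \<times> (UNIV :: 'b set) \<in> sets (lborel \<Otimes>\<^sub>M lborel)"
    using N by (intro pair_measureI) auto
  ultimately have "N \<times> (UNIV :: 'b set) \<in> null_sets (lborel \<Otimes>\<^sub>M lborel)"
    by (rule null_setsI)
  then have "N \<times> (UNIV :: 'b set) \<in> null_sets lborel" unfolding lborel_prod .
  then show ?thesis by (rule AE_I') (use N(2) in auto)
qed

lemma AE_lborel_snd:
  assumes "AE x in (lborel :: 'b::euclidean_space measure). P x"
  shows "AE z in (lborel :: ('a::euclidean_space \<times> 'b) measure). P (snd z)"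
proof -
  obtain N where N: "N \<in> null_sets lborel" "{x. \<not> P x} \<subseteq> N"
    using assms by (auto simp: null_sets_def elim!: AE_E)
  then have "emeasure (lborel \<Otimes>\<^sub>M lborel) ((UNIV :: 'a set) \<times> N) = 0"
    by (subst lborel.emeasure_pair_measure_Times) auto
  moreover have "(UNIV :: 'a set) \<times> N \<in> sets (lborel \<Otimes>\<^sub>M lborel)"
    using N by (intro pair_measureI) auto
  ultimately have "(UNIV :: 'a set) \<times> N \<in> null_sets (lborel \<Otimes>\<^sub>M lborel)"
    by (rule null_setsI)
  then have "(UNIV :: 'a set) \<times> N \<in> null_sets lborel" unfolding lborel_prod .
  then show ?thesis by (rule AE_I') (use N(2) in auto)
qed

text \<open>Compose a Borel version of \<open>u\<close> with the projections. The result changes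
  only on the product of a null set with the whole space, which is again a null set.\<close>

lemma lebesgue_measurable_fst_snd:
  fixes u :: "'a::euclidean_space \<Rightarrow> real"
  assumes "u \<in> borel_measurable lebesgue"
  shows "(\<lambda>z. u (fst z)) \<in> borel_measurable (lebesgue :: ('a \<times> 'a) measure)"
    and "(\<lambda>z. u (snd z)) \<in> borel_measurable (lebesgue :: ('a \<times> 'a) measure)"
proof -
  obtain v where vm: "v \<in> borel_measurable borel" and v: "AE x in lborel. u x = v x"
    using completion_ex_borel_measurable_real[OF assms] by auto
  have m: "(\<lambda>z. v (fst z)) \<in> borel_measurable (lebesgue :: ('a \<times> 'a) measure)"
      "(\<lambda>z. v (snd z)) \<in> borel_measurable (lebesgue :: ('a \<times> 'a) measure)"
    using measurable_compose[OF fst_snd_borel(1) vm] measurable_compose[OF fst_snd_borel(2) vm]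
    by (intro measurable_completion; simp)+
  show "(\<lambda>z. u (fst z)) \<in> borel_measurable (lebesgue :: ('a \<times> 'a) measure)"
    by (rule borel_measurable_AE[OF m(1)]) (use AE_lborel_fst[OF v] in \<open>auto intro!: AE_completion\<close>)
  show "(\<lambda>z. u (snd z)) \<in> borel_measurable (lebesgue :: ('a \<times> 'a) measure)"
    by (rule borel_measurable_AE[OF m(2)]) (use AE_lborel_snd[OF v] in \<open>auto intro!: AE_completion\<close>)
qed

lemma AE_lborel_translation:
  fixes a :: "'a::euclidean_space"
  assumes "AE x in lborel. P x"
  shows "AE x in lborel. P (a + x)"
proof -
  have "AE x in distr lborel borel ((+) a). P x" using assms by (subst lborel_distr_plus)
  then show ?thesis by (rule AE_distrD[rotated]) simp
qed

lemma nn_integral_lborel_translation_AE: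
  fixes f :: "'a::euclidean_space \<Rightarrow> ennreal"
  assumes [measurable]: "f' \<in> borel_measurable borel" and eq: "AE x in lborel. f x = f' x"
  shows "(\<integral>\<^sup>+x. f (a + x) \<partial>lborel) = (\<integral>\<^sup>+x. f x \<partial>lborel)"
proof -
  have "(\<integral>\<^sup>+x. f (a + x) \<partial>lborel) = (\<integral>\<^sup>+x. f' (a + x) \<partial>lborel)"
    by (rule nn_integral_cong_AE[OF AE_lborel_translation[OF eq]])
  also have "\<dots> = (\<integral>\<^sup>+x. f' x \<partial>lborel)" by (rule nn_integral_lborel_translation) simp
  also have "\<dots> = (\<integral>\<^sup>+x. f x \<partial>lborel)" by (rule nn_integral_cong_AE) (use eq in auto)
  finally show ?thesis .
qed

section \<open>The integer lattice and periodic functions\<close>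

definition lattice_floor :: "real^'n \<Rightarrow> real^'n" where
  "lattice_floor x = (\<chi> i. real_of_int \<lfloor>x $ i\<rfloor>)"

text \<open>Written as the range of a map on a countable type, which makes countability
  immediate.\<close>

definition lattice :: "(real^'n) set" where
  "lattice = range (\<lambda>a::'n \<Rightarrow> int. \<chi> i. real_of_int (a i))"

lemma countable_lattice: "countable (lattice :: (real^'n) set)"
  unfolding lattice_def by (intro countable_image countableI_type)

lemma lattice_iff:
  fixes k :: "real^'n"
  shows "k \<in> lattice \<longleftrightarrow> (\<forall>i. k $ i \<in> \<int>)"
proof
  assume k: "\<forall>i. k $ i \<in> \<int>"
  have "k = (\<chi> i. real_of_int \<lfloor>k $ i\<rfloor>)" using k by (simp add: vec_eq_iff)
  then show "k \<in> lattice" unfolding lattice_def by (rule image_eqI[where x = "\<lambda>i. \<lfloor>k $ i\<rfloor>"]) simp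
qed (auto simp: lattice_def)

lemma lattice_floor_in: "lattice_floor x \<in> lattice"
  by (simp add: lattice_iff lattice_floor_def)

lemma Zn_periodicD: "Zn_periodic f \<Longrightarrow> k \<in> lattice \<Longrightarrow> f (x + k) = f x"
  by (simp add: Zn_periodic_def lattice_iff)

lemma uminus_lattice: "k \<in> lattice \<Longrightarrow> - k \<in> lattice"
  by (simp add: lattice_iff)

text \<open>It fails only when some coordinate is an integer, that is, on countably many
  hyperplanes.\<close>

lemma AE_minus_lattice_floor_in_unit_cube: "AE x in lborel. x - lattice_floor x \<in> (unit_cube :: (real^'n) set)"
proof -
  have "AE x in lborel. x $ i \<noteq> real_of_int c" for i :: 'n and c :: int
  proof -
    have "{x :: real^'n. x $ i = real_of_int c} \<in> null_sets lebesgue"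
      using negligible_standard_hyperplane[of "axis i (1::real)" "real_of_int c"]
      by (simp add: negligible_iff_null_sets inner_axis axis_in_Basis_iff Basis_real_def)
    then have "AE x in lebesgue. x \<notin> {x :: real^'n. x $ i = real_of_int c}" by (rule AE_not_in)
    then show ?thesis by (simp add: AE_completion_iff)
  qed
  then have "AE x in lborel. \<forall>(i :: 'n) (c :: int). x $ i \<noteq> real_of_int c"
    by (simp add: AE_all_countable)
  then show ?thesis
  proof eventually_elim
    case (elim x)
    have "0 < x $ i - real_of_int \<lfloor>x $ i\<rfloor> \<and> x $ i - real_of_int \<lfloor>x $ i\<rfloor> < 1" for i
    proof -
      have "x $ i \<noteq> real_of_int \<lfloor>x $ i\<rfloor>" using elim by blast
      then show ?thesis using floor_correct[of "x $ i"] by linarith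
    qed
    then show ?case by (simp add: mem_unit_cube lattice_floor_def)
  qed
qed

text \<open>Countably many lattice translates of the exceptional set are still null, and almost
  every point is moved into the cube by a lattice vector. \<open>Zn_periodic\<close> is used here
  for a predicate.\<close>

lemma AE_periodic:
  fixes P :: "real^'n \<Rightarrow> bool"
  assumes "Zn_periodic P" and "AE x in lborel. x \<in> unit_cube \<longrightarrow> P x"
  shows "AE x in lborel. P x"
proof -
  have "AE x in lborel. - k + x \<in> unit_cube \<longrightarrow> P (- k + x)" for k :: "real^'n"
    by (rule AE_lborel_translation[OF assms(2)])
  then have "AE x in lborel. \<forall>k\<in>lattice. - k + x \<in> unit_cube \<longrightarrow> P (- k + x)"
    by (simp add: AE_ball_countable countable_lattice)
  with AE_minus_lattice_floor_in_unit_cube show ?thesis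
  proof eventually_elim
    case (elim x)
    then have "P (x + - lattice_floor x)" using lattice_floor_in by (auto simp: add.commute)
    then show ?case
      using Zn_periodicD[OF assms(1) uminus_lattice[OF lattice_floor_in], of x x] by simp
  qed
qed

text \<open>Up to a null set, finitely many lattice translates of the cube cover the compact set,
  and each contributes the integral of \<open>\<bar>u\<bar>\<close> over the cube.\<close>

lemma periodic_locally_integrable:
  fixes u :: "real^'n \<Rightarrow> real"
  assumes u[measurable]: "u \<in> borel_measurable lebesgue" and per: "Zn_periodic u"
    and int: "set_integrable lebesgue unit_cube u" and "compact C"
  shows "set_integrable lebesgue C u"
proof -
  obtain b where b: "\<And>x. x \<in> C \<Longrightarrow> norm x \<le> b"
    using compact_imp_bounded[OF \<open>compact C\<close>] by (auto simp: bounded_iff)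
  \<comment> \<open>A finite set of lattice vectors containing \<open>lattice_floor x\<close> for
    every \<open>x\<close> in \<open>C\<close>, whose coordinates are at most \<open>b\<close> in
    absolute value.\<close>
  define F where "F = (\<lambda>a::'n \<Rightarrow> int. (\<chi> i. real_of_int (a i)) :: real^'n) ` Pi\<^sub>E UNIV (\<lambda>_. {\<lfloor>-b\<rfloor>..\<lceil>b\<rceil>})"
  have finF: "finite F" unfolding F_def by (intro finite_imageI finite_PiE) auto
  have F_lattice: "k \<in> lattice" if "k \<in> F" for k using that by (auto simp: F_def lattice_def)
  have floor_F: "lattice_floor x \<in> F" if "x \<in> C" for x
  proof -
    have "\<bar>x $ i\<bar> \<le> b" for i using b[OF that] component_le_norm_cart[of x i] by linarith
    then have "\<lfloor>-b\<rfloor> \<le> \<lfloor>x $ i\<rfloor> \<and> \<lfloor>x $ i\<rfloor> \<le> \<lceil>b\<rceil>" for i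
      using floor_mono[of "-b" "x $ i"] floor_mono[of "x $ i" b] floor_le_ceiling[of b]
      by (meson abs_le_iff minus_le_iff order_trans)
    then show ?thesis unfolding F_def lattice_floor_def by (intro image_eqI[where x = "\<lambda>i. \<lfloor>x $ i\<rfloor>"]) auto
  qed
  let ?f = "\<lambda>x. ennreal \<bar>u x\<bar> * indicator unit_cube x"
  have [measurable]: "C \<in> sets lebesgue" using \<open>compact C\<close> by (simp add: lmeasurable_compact fmeasurableD)
  have "(\<lambda>x. ennreal \<bar>u x\<bar> * indicator unit_cube x) \<in> borel_measurable lebesgue" by measurable
  then obtain f' where f': "f' \<in> borel_measurable lborel" "AE x in lborel. ?f x = f' x"
    using completion_ex_borel_measurable by blast
  have fin: "(\<integral>\<^sup>+x. ?f x \<partial>lborel) < \<infinity>"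
  proof -
    have "(\<integral>\<^sup>+x. ennreal (norm (indicator unit_cube x *\<^sub>R u x)) \<partial>lebesgue) < \<infinity>"
      using int unfolding set_integrable_def by (simp add: integrable_iff_bounded)
    also have "(\<integral>\<^sup>+x. ennreal (norm (indicator unit_cube x *\<^sub>R u x)) \<partial>lebesgue) = (\<integral>\<^sup>+x. ?f x \<partial>lebesgue)"
      by (intro nn_integral_cong) (auto simp: indicator_def)
    finally show ?thesis by (simp add: nn_integral_completion)
  qed
  have cover: "AE x in lborel. ennreal (norm (indicator C x *\<^sub>R u x)) \<le> (\<Sum>k\<in>F. ?f (- k + x))"
    using AE_minus_lattice_floor_in_unit_cube
  proof eventually_elim
    case (elim x)
    show "ennreal (norm (indicator C x *\<^sub>R u x)) \<le> (\<Sum>k\<in>F. ?f (- k + x))"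
    proof (cases "x \<in> C")
      case True
      have "u (- lattice_floor x + x) = u x"
        using Zn_periodicD[OF per uminus_lattice[OF lattice_floor_in], of x x] by (simp add: add.commute)
      moreover have "- lattice_floor x + x \<in> unit_cube" using elim by simp
      ultimately have "ennreal (norm (indicator C x *\<^sub>R u x)) = ?f (- lattice_floor x + x)"
        using True by simp
      also have "\<dots> \<le> (\<Sum>k\<in>F. ?f (- k + x))"
        by (rule member_le_sum[OF floor_F[OF True] _ finF]) auto
      finally show ?thesis .
    qed simp
  qed
  have "(\<integral>\<^sup>+x. ennreal (norm (indicator C x *\<^sub>R u x)) \<partial>lebesgue) = (\<integral>\<^sup>+x. ennreal (norm (indicator C x *\<^sub>R u x)) \<partial>lborel)"
    by (rule nn_integral_completion)
  also have "\<dots> \<le> (\<integral>\<^sup>+x. (\<Sum>k\<in>F. ?f (- k + x)) \<partial>lborel)"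
    by (rule nn_integral_mono_AE[OF cover])
  also have "\<dots> = (\<integral>\<^sup>+x. (\<Sum>k\<in>F. f' (- k + x)) \<partial>lborel)"
  proof (rule nn_integral_cong_AE)
    have "AE x in lborel. \<forall>k\<in>F. ?f (- k + x) = f' (- k + x)"
      by (intro AE_ball_countable[THEN iffD2, OF countable_finite[OF finF]] ballI AE_lborel_translation[OF f'(2)])
    then show "AE x in lborel. (\<Sum>k\<in>F. ?f (- k + x)) = (\<Sum>k\<in>F. f' (- k + x))"
      by eventually_elim (intro sum.cong; simp)
  qed
  also have "\<dots> = (\<Sum>k\<in>F. \<integral>\<^sup>+x. f' (- k + x) \<partial>lborel)"
    using f'(1) by (intro nn_integral_sum) auto
  also have "\<dots> = (\<Sum>k\<in>F. \<integral>\<^sup>+x. ?f x \<partial>lborel)"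
  proof (rule sum.cong[OF refl])
    fix k
    have "(\<integral>\<^sup>+x. f' (- k + x) \<partial>lborel) = (\<integral>\<^sup>+x. f' x \<partial>lborel)"
      using f'(1) by (intro nn_integral_lborel_translation) auto
    also have "\<dots> = (\<integral>\<^sup>+x. ?f x \<partial>lborel)"
      by (rule nn_integral_cong_AE) (use f'(2) in auto)
    finally show "(\<integral>\<^sup>+x. f' (- k + x) \<partial>lborel) = (\<integral>\<^sup>+x. ?f x \<partial>lborel)" .
  qed
  also have "\<dots> < \<infinity>" using fin by (simp add: ennreal_mult_less_top ennreal_of_nat_eq_real_of_nat)
  finally show ?thesis
    unfolding set_integrable_def using u by (intro integrableI_bounded) auto
qed

text \<open>\<open>u\<close> is the pointwise limit of its restrictions to growing balls, which are
  integrable and hence measurable.\<close>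

lemma cell_space_measurable:
  assumes "u \<in> cell_space"
  shows "u \<in> borel_measurable lebesgue"
proof (rule borel_measurable_LIMSEQ_real)
  fix k :: nat
  have "set_integrable lebesgue (cball 0 (real k)) u" using assms by (auto simp: cell_space_def)
  then show "(\<lambda>x. indicator (cball 0 (real k)) x *\<^sub>R u x) \<in> borel_measurable lebesgue"
    by (auto simp: set_integrable_def)
next
  fix x :: "real^'a"
  obtain k0 where k0: "norm x \<le> real k0" using real_arch_simple by blast
  have "\<forall>\<^sub>F k in sequentially. indicator (cball 0 (real k)) x *\<^sub>R u x = u x"
    using eventually_ge_at_top[of k0]
  proof eventually_elim
    case (elim k)
    then have "real k0 \<le> real k" by simp
    then show ?case using k0 by (auto simp: indicator_def)
  qed
  then show "(\<lambda>k. indicator (cball 0 (real k)) x *\<^sub>R u x) \<longlonglongrightarrow> u x" by (rule tendsto_eventually)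
qed

lemma cell_space_integrable:
  assumes "u \<in> cell_space"
  shows "set_integrable lebesgue unit_cube u"
proof (rule set_integrable_subset)
  show "set_integrable lebesgue (cbox 0 One) u" using assms compact_cbox unfolding cell_space_def by blast
  show "unit_cube \<subseteq> cbox 0 One" unfolding unit_cube_def by (rule box_subset_cbox)
qed auto

lemma frac_seminorm_eq_prod:
  fixes u :: "real^'n \<Rightarrow> real"
  assumes [measurable]: "u \<in> borel_measurable borel"
  shows "frac_seminorm \<alpha> \<delta> u = (\<integral>\<^sup>+z. indicator (unit_cube \<times> unit_cube) z *
     ennreal (\<bar>u (fst z) - u (snd z)\<bar> * frac_kernel \<alpha> \<delta> (fst z - snd z)) \<partial>lborel)"
proof -
  let ?F = "\<lambda>z. indicator (unit_cube \<times> unit_cube) z *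
     ennreal (\<bar>u (fst z) - u (snd z)\<bar> * frac_kernel \<alpha> \<delta> (fst z - snd z))"
  have [measurable]: "(unit_cube \<times> unit_cube :: ((real^'n) \<times> (real^'n)) set) \<in> sets borel"
    unfolding borel_prod[symmetric] by (intro pair_measureI) auto
  have "(\<integral>\<^sup>+z. ?F z \<partial>lborel) = (\<integral>\<^sup>+z. ?F z \<partial>(lborel \<Otimes>\<^sub>M lborel))"
    by (simp add: lborel_prod)
  also have "\<dots> = (\<integral>\<^sup>+x. \<integral>\<^sup>+y. ?F (x, y) \<partial>lborel \<partial>lborel)"
    by (rule lborel.nn_integral_fst[symmetric]) (simp add: lborel_prod)
  also have "\<dots> = frac_seminorm \<alpha> \<delta> u"
    unfolding frac_seminorm_def
    by (intro nn_integral_cong) (auto simp: indicator_def indicator_times intro!: nn_integral_cong)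
  finally show ?thesis by simp
qed

subsection \<open>Coercivity and existence of minimizers\<close>

text \<open>By symmetry and translation invariance the integrand depends on \<open>y - x\<close>
  only, so the inner integral is the one in \<open>kernel_K2\<close>, and the cube has measure 1. A
  Borel version \<open>G'\<close> of the integrand gives access to iterated integrals.\<close>

lemma kernel_first_moment_finite:
  fixes K :: "real^'n \<Rightarrow> real^'n \<Rightarrow> real"
  assumes K: "kernel_K0 K" "kernel_K1 K" "kernel_K2 K"
  shows "(\<integral>\<^sup>+z. indicator (unit_cube \<times> UNIV) z * ennreal (norm (fst z - snd z) * K (fst z) (snd z)) \<partial>lebesgue) < \<infinity>"
proof -
  define G where "G z = norm (fst z - snd z) * K (fst z) (snd z)" for z
  define k where "k h = ennreal (norm h * K h 0)" for h
  have QU[measurable]: "(unit_cube \<times> UNIV :: ((real^'n) \<times> (real^'n)) set) \<in> sets borel"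
    unfolding borel_prod[symmetric] by (intro pair_measureI) auto
  have "(\<lambda>z. norm (fst z - snd z)) \<in> borel_measurable (lebesgue :: ((real^'n) \<times> (real^'n)) measure)"
    by (intro measurable_completion) simp
  then have "G \<in> borel_measurable lebesgue"
    unfolding G_def[abs_def] using K(1) by (auto simp: kernel_K0_def)
  then obtain G' where G'[measurable]: "G' \<in> borel_measurable borel" and eq: "AE z in lborel. G z = G' z"
    using completion_ex_borel_measurable_real by force
  have eqk: "ennreal (G (x, y)) = k (- x + y)" for x y
  proof -
    have "K x y = K (y + - x) (x + - x)" using K(2) unfolding kernel_K1_def by metis
    then show ?thesis by (simp add: G_def k_def norm_minus_commute)
  qed
  have "AE z in lborel \<Otimes>\<^sub>M lborel. G z = G' z" unfolding lborel_prod by (rule eq)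
  then have AEx: "AE x in lborel. AE y in lborel. G (x, y) = G' (x, y)"
    by (rule lborel_pair.AE_pair)
  have inner: "AE x in lborel. (\<integral>\<^sup>+y. ennreal (G' (x, y)) \<partial>lborel) = (\<integral>\<^sup>+h. k h \<partial>lborel)"
    using AEx
  proof eventually_elim
    case (elim x)
    have G'x[measurable]: "(\<lambda>y. ennreal (G' (x, y))) \<in> borel_measurable borel"
      using G' unfolding borel_prod[symmetric] by measurable
    have a: "AE y in lborel. k (- x + y) = ennreal (G' (x, y))"
      using elim unfolding eqk[symmetric] by eventually_elim simp
    have "(\<integral>\<^sup>+y. ennreal (G' (x, y)) \<partial>lborel) = (\<integral>\<^sup>+y. k (- x + y) \<partial>lborel)"
      by (rule nn_integral_cong_AE) (use a in auto)
    also have "\<dots> = (\<integral>\<^sup>+y. k (- x + (x + y)) \<partial>lborel)"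
      by (rule nn_integral_lborel_translation_AE[OF G'x a, symmetric])
    finally show ?case by simp
  qed
  have "(\<integral>\<^sup>+z. indicator (unit_cube \<times> UNIV) z * ennreal (G z) \<partial>lebesgue)
      = (\<integral>\<^sup>+z. indicator (unit_cube \<times> UNIV) z * ennreal (G z) \<partial>lborel)"
    by (rule nn_integral_completion)
  also have "\<dots> = (\<integral>\<^sup>+z. indicator (unit_cube \<times> UNIV) z * ennreal (G' z) \<partial>lborel)"
    by (rule nn_integral_cong_AE) (use eq in eventually_elim, simp)
  also have "\<dots> = (\<integral>\<^sup>+z. indicator (unit_cube \<times> UNIV) z * ennreal (G' z) \<partial>(lborel \<Otimes>\<^sub>M lborel))"
    by (simp add: lborel_prod)
  also have "\<dots> = (\<integral>\<^sup>+x. \<integral>\<^sup>+y. indicator (unit_cube \<times> UNIV) (x, y) * ennreal (G' (x, y)) \<partial>lborel \<partial>lborel)"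
    by (rule lborel.nn_integral_fst[symmetric]) (unfold lborel_prod, measurable)
  also have "\<dots> = (\<integral>\<^sup>+x. (\<integral>\<^sup>+y. ennreal (G' (x, y)) \<partial>lborel) * indicator unit_cube x \<partial>lborel)"
    by (intro nn_integral_cong) (auto simp: indicator_def)
  also have "\<dots> = (\<integral>\<^sup>+x. (\<integral>\<^sup>+h. k h \<partial>lborel) * indicator unit_cube x \<partial>(lborel :: (real^'n) measure))"
    by (rule nn_integral_cong_AE) (use inner in eventually_elim, simp)
  also have "\<dots> = (\<integral>\<^sup>+h. k h \<partial>lborel)"
    by (subst nn_integral_cmult_indicator) (auto simp: emeasure_unit_cube)
  also have "\<dots> < \<infinity>"
    using K(3) unfolding kernel_K2_def k_def by (simp add: nn_integral_completion)
  finally show ?thesis unfolding G_def .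
qed

text \<open>Young's inequality for \<open>\<bar>g x\<bar> / \<gamma>\<close> and
  \<open>\<bar>u x\<bar> / A\<close>, multiplied by \<open>\<gamma> * A\<close> and integrated; the
  weights \<open>a\<close> and \<open>b\<close> undo the normalization.\<close>

lemma Hoelder_bound:
  fixes g u :: "'a \<Rightarrow> real"
  assumes [measurable]: "g \<in> borel_measurable M" "u \<in> borel_measurable M"
    and pq: "p > 1" "q > 1" "1 / p + 1 / q = 1" and A: "A > 0" and \<gamma>: "\<gamma> > 0"
    and g: "(\<integral>\<^sup>+x. ennreal (\<bar>g x\<bar> powr p) \<partial>M) \<le> ennreal (\<gamma> powr p)"
    and u: "(\<integral>\<^sup>+x. ennreal (\<bar>u x\<bar> powr q) \<partial>M) \<le> ennreal (A powr q)"
  shows "(\<integral>\<^sup>+x. ennreal \<bar>g x * u x\<bar> \<partial>M) \<le> ennreal (\<gamma> * A)"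
proof -
  define a b where "a = \<gamma> * A / (p * \<gamma> powr p)" and "b = \<gamma> * A / (q * A powr q)"
  have ab: "a \<ge> 0" "b \<ge> 0" using pq A \<gamma> by (auto simp: a_def b_def)
  have pw: "ennreal \<bar>g x * u x\<bar> \<le> ennreal a * ennreal (\<bar>g x\<bar> powr p) + ennreal b * ennreal (\<bar>u x\<bar> powr q)" for x
  proof -
    have "(\<bar>g x\<bar> / \<gamma>) * (\<bar>u x\<bar> / A) \<le> (\<bar>g x\<bar> / \<gamma>) powr p / p + (\<bar>u x\<bar> / A) powr q / q"
      using pq A \<gamma> by (intro Youngs_inequality) auto
    then have "(\<gamma> * A) * ((\<bar>g x\<bar> / \<gamma>) * (\<bar>u x\<bar> / A)) \<le> (\<gamma> * A) * ((\<bar>g x\<bar> / \<gamma>) powr p / p + (\<bar>u x\<bar> / A) powr q / q)"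
      using A \<gamma> by (intro mult_left_mono) auto
    also have "(\<gamma> * A) * ((\<bar>g x\<bar> / \<gamma>) * (\<bar>u x\<bar> / A)) = \<bar>g x * u x\<bar>"
      using A \<gamma> by (simp add: abs_mult)
    also have "(\<gamma> * A) * ((\<bar>g x\<bar> / \<gamma>) powr p / p + (\<bar>u x\<bar> / A) powr q / q) = a * \<bar>g x\<bar> powr p + b * \<bar>u x\<bar> powr q"
      using A \<gamma> by (simp add: a_def b_def powr_divide distrib_left mult.commute)
    finally have "ennreal \<bar>g x * u x\<bar> \<le> ennreal (a * \<bar>g x\<bar> powr p + b * \<bar>u x\<bar> powr q)" by (rule ennreal_leI)
    then show ?thesis using ab by (simp add: ennreal_plus ennreal_mult)
  qed
  have "(\<integral>\<^sup>+x. ennreal \<bar>g x * u x\<bar> \<partial>M) \<le> (\<integral>\<^sup>+x. (ennreal a * ennreal (\<bar>g x\<bar> powr p) + ennreal b * ennreal (\<bar>u x\<bar> powr q)) \<partial>M)"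
    by (intro nn_integral_mono pw)
  also have "\<dots> = ennreal a * (\<integral>\<^sup>+x. ennreal (\<bar>g x\<bar> powr p) \<partial>M) + ennreal b * (\<integral>\<^sup>+x. ennreal (\<bar>u x\<bar> powr q) \<partial>M)"
    by (simp add: nn_integral_add nn_integral_cmult)
  also have "\<dots> \<le> ennreal a * ennreal (\<gamma> powr p) + ennreal b * ennreal (A powr q)"
    by (intro add_mono mult_left_mono g u) auto
  also have "\<dots> = ennreal (a * \<gamma> powr p + b * A powr q)"
    using ab by (simp add: ennreal_plus ennreal_mult)
  also have "a * \<gamma> powr p + b * A powr q = (\<gamma> * A) * (1 / p + 1 / q)"
    using A \<gamma> by (simp add: a_def b_def distrib_left)
  finally show ?thesis using pq by simp
qed

section \<open>The interaction energy for fixed data, its coercivity and the direct method\<close>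

definition interaction_energy ::
  "(real^'n \<Rightarrow> real^'n \<Rightarrow> real) \<Rightarrow> real^'n \<Rightarrow> (real^'n \<Rightarrow> real) \<Rightarrow> ennreal" where
  "interaction_energy K p u = (\<integral>\<^sup>+ z. indicator (unit_cube \<times> UNIV) z *
     ennreal (\<bar>u (fst z) - u (snd z) + p \<bullet> (fst z - snd z)\<bar> * K (fst z) (snd z) / 2) \<partial>lebesgue)"

lemma unit_cube_times_lebesgue [measurable]:
  "(unit_cube \<times> UNIV :: ((real^'n) \<times> (real^'n)) set) \<in> sets lebesgue"
  "(unit_cube \<times> unit_cube :: ((real^'n) \<times> (real^'n)) set) \<in> sets lebesgue"
proof -
  have "(unit_cube \<times> UNIV :: ((real^'n) \<times> (real^'n)) set) \<in> sets borel"
    "(unit_cube \<times> unit_cube :: ((real^'n) \<times> (real^'n)) set) \<in> sets borel"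
    unfolding borel_prod[symmetric] by (intro pair_measureI; simp)+
  then show "(unit_cube \<times> UNIV :: ((real^'n) \<times> (real^'n)) set) \<in> sets lebesgue"
    "(unit_cube \<times> unit_cube :: ((real^'n) \<times> (real^'n)) set) \<in> sets lebesgue"
    by (auto intro!: sets_completionI_sets)
qed

lemma inner_diff_lebesgue [measurable]:
  "(\<lambda>z. p \<bullet> (fst z - snd z)) \<in> borel_measurable (lebesgue :: ((real^'n) \<times> (real^'n)) measure)"
  by (intro measurable_completion) simp

text \<open>The Sobolev-Poincare inequality is an assumption here, because the constant \<open>C\<close> has to be chosen
  before the kernel and the forcing term.\<close>

locale cell_problem =
  fixes K :: "real^'n \<Rightarrow> real^'n \<Rightarrow> real" and g :: "real^'n \<Rightarrow> real" and p :: "real^'n"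
    and \<alpha> \<delta> \<kappa> C M :: real
  assumes K0: "kernel_K0 K" and K1: "kernel_K1 K" and K2: "kernel_K2 K"
    and lower: "\<And>x y. \<kappa> * frac_kernel \<alpha> \<delta> (x - y) \<le> K x y"
    and \<alpha>: "0 < \<alpha>" "\<alpha> < real CARD('n)" and \<delta>: "0 < \<delta>" and \<kappa>: "0 < \<kappa>" and C: "0 < C"
    and sobolev_Poincare:
    "\<And>(u :: real^'n \<Rightarrow> real) j. u \<in> borel_measurable borel \<Longrightarrow> set_integrable lborel unit_cube u \<Longrightarrow>
       (LINT x:unit_cube|lborel. u x) = 0 \<Longrightarrow> 0 \<le> j \<Longrightarrow> frac_seminorm \<alpha> \<delta> u \<le> ennreal j \<Longrightarrow>
       (\<integral>\<^sup>+x\<in>unit_cube. ennreal \<bar>u x\<bar> \<partial>lborel) \<le> ennreal (C * j) \<and>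
       (\<integral>\<^sup>+x\<in>unit_cube. ennreal (\<bar>u x\<bar> powr (real CARD('n) / (real CARD('n) - \<alpha>))) \<partial>lborel)
         \<le> ennreal ((C * j) powr (real CARD('n) / (real CARD('n) - \<alpha>)))"
    and g_measurable [measurable]: "g \<in> borel_measurable lebesgue"
    and g_bounded: "AE x in lebesgue. \<bar>g x\<bar> \<le> M"
    and g_small: "(\<integral>\<^sup>+x\<in>unit_cube. ennreal (\<bar>g x\<bar> powr (real CARD('n) / \<alpha>)) \<partial>lebesgue)
        \<le> ennreal ((\<kappa> / (4 * C)) powr (real CARD('n) / \<alpha>))"
begin

lemma K_measurable [measurable]: "(\<lambda>z. K (fst z) (snd z)) \<in> borel_measurable lebesgue"
  using K0 by (simp add: kernel_K0_def)

lemma K_nonneg: "0 \<le> K x y"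
  using K0 by (simp add: kernel_K0_def)

text \<open>Twice the interaction energy of the zero function: the price for discarding the linear
  part from an increment.\<close>

definition tilt_energy :: ennreal where
  "tilt_energy = (\<integral>\<^sup>+ z. indicator (unit_cube \<times> UNIV) z *
     ennreal (\<bar>p \<bullet> (fst z - snd z)\<bar> * K (fst z) (snd z)) \<partial>lebesgue)"

lemma tilt_energy_finite: "tilt_energy < top"
proof -
  let ?G = "\<lambda>z. indicator (unit_cube \<times> UNIV) z * ennreal (norm (fst z - snd z) * K (fst z) (snd z))"
  have nm: "(\<lambda>z. norm (fst z - snd z)) \<in> borel_measurable (lebesgue :: ((real^'n) \<times> (real^'n)) measure)"
    by (intro measurable_completion) simp
  have "tilt_energy \<le> (\<integral>\<^sup>+z. ennreal (norm p) * ?G z \<partial>lebesgue)"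
    unfolding tilt_energy_def
  proof (rule nn_integral_mono)
    fix z :: "(real^'n) \<times> (real^'n)"
    have "\<bar>p \<bullet> (fst z - snd z)\<bar> * K (fst z) (snd z) \<le> (norm p * norm (fst z - snd z)) * K (fst z) (snd z)"
      by (intro mult_right_mono Cauchy_Schwarz_ineq2 K_nonneg)
    then have "ennreal (\<bar>p \<bullet> (fst z - snd z)\<bar> * K (fst z) (snd z)) \<le> ennreal (norm p * (norm (fst z - snd z) * K (fst z) (snd z)))"
      by (intro ennreal_leI) (simp add: mult.assoc)
    then show "indicator (unit_cube \<times> UNIV) z * ennreal (\<bar>p \<bullet> (fst z - snd z)\<bar> * K (fst z) (snd z)) \<le> ennreal (norm p) * ?G z"
      using K_nonneg by (simp add: ennreal_mult indicator_def)
  qed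
  also have "\<dots> = ennreal (norm p) * (\<integral>\<^sup>+z. ?G z \<partial>lebesgue)"
    using nm K_measurable
    by (intro nn_integral_cmult borel_measurable_times_ennreal borel_measurable_indicator
        measurable_compose[OF _ measurable_ennreal] borel_measurable_times unit_cube_times_lebesgue)
  also have "\<dots> < top"
    using kernel_first_moment_finite[OF K0 K1 K2] by (simp add: ennreal_mult_less_top)
  finally show ?thesis .
qed

lemma interaction_integrand_measurable:
  assumes "u \<in> borel_measurable lebesgue"
  shows "(\<lambda>z. indicator (unit_cube \<times> UNIV) z *
     ennreal (\<bar>u (fst z) - u (snd z) + p \<bullet> (fst z - snd z)\<bar> * K (fst z) (snd z) / 2)) \<in> borel_measurable lebesgue"
proof -
  note [measurable] = lebesgue_measurable_fst_snd[OF assms]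
  show ?thesis
    by (intro borel_measurable_times_ennreal borel_measurable_indicator unit_cube_times_lebesgue) measurable
qed

text \<open>Bound the kernel below by \<open>lower\<close>, use the triangle inequality to insert
  the linear part, and enlarge the domain from \<open>Q \<times> Q\<close> to
  \<open>Q \<times> UNIV\<close>; the factor 2 undoes the 1/2 in the energy. The seminorm is taken
  of a Borel version \<open>v\<close>.\<close>

lemma frac_seminorm_le_energy:
  assumes u: "u \<in> borel_measurable lebesgue" and v[measurable]: "v \<in> borel_measurable borel"
    and uv: "AE x in lborel. u x = v x"
  shows "ennreal \<kappa> * frac_seminorm \<alpha> \<delta> v \<le> 2 * interaction_energy K p u + tilt_energy"
proof -
  note [measurable] = lebesgue_measurable_fst_snd[OF u]
  let ?QQ = "unit_cube \<times> unit_cube :: ((real^'n) \<times> (real^'n)) set"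
  let ?QU = "unit_cube \<times> UNIV :: ((real^'n) \<times> (real^'n)) set"
  have [measurable]: "?QQ \<in> sets borel"
    unfolding borel_prod[symmetric] by (intro pair_measureI) auto
  have vf[measurable]: "(\<lambda>z. v (fst z)) \<in> borel_measurable (borel :: ((real^'n) \<times> (real^'n)) measure)"
      "(\<lambda>z. v (snd z)) \<in> borel_measurable (borel :: ((real^'n) \<times> (real^'n)) measure)"
    by (rule measurable_compose[OF fst_snd_borel(1) v] measurable_compose[OF fst_snd_borel(2) v])+
  have wf[measurable]: "(\<lambda>z. frac_kernel \<alpha> \<delta> (fst z - snd z)) \<in> borel_measurable (borel :: ((real^'n) \<times> (real^'n)) measure)"
    by (rule measurable_compose[OF _ frac_kernel_measurable]) simp
  have "ennreal \<kappa> * frac_seminorm \<alpha> \<delta> v = (\<integral>\<^sup>+z. ennreal \<kappa> * (indicator ?QQ z *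
      ennreal (\<bar>v (fst z) - v (snd z)\<bar> * frac_kernel \<alpha> \<delta> (fst z - snd z))) \<partial>lborel)"
    unfolding frac_seminorm_eq_prod[OF v] by (intro nn_integral_cmult[symmetric]) simp
  also have "\<dots> = (\<integral>\<^sup>+z. ennreal \<kappa> * (indicator ?QQ z *
      ennreal (\<bar>u (fst z) - u (snd z)\<bar> * frac_kernel \<alpha> \<delta> (fst z - snd z))) \<partial>lborel)"
  proof (rule nn_integral_cong_AE)
    show "AE z in lborel. ennreal \<kappa> * (indicator ?QQ z *
        ennreal (\<bar>v (fst z) - v (snd z)\<bar> * frac_kernel \<alpha> \<delta> (fst z - snd z))) = ennreal \<kappa> * (indicator ?QQ z *
        ennreal (\<bar>u (fst z) - u (snd z)\<bar> * frac_kernel \<alpha> \<delta> (fst z - snd z)))"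
      using AE_lborel_fst[OF uv] AE_lborel_snd[OF uv] by eventually_elim simp
  qed
  also have "\<dots> = (\<integral>\<^sup>+z. ennreal \<kappa> * (indicator ?QQ z *
      ennreal (\<bar>u (fst z) - u (snd z)\<bar> * frac_kernel \<alpha> \<delta> (fst z - snd z))) \<partial>lebesgue)"
    by (rule nn_integral_completion[symmetric])
  also have "\<dots> \<le> (\<integral>\<^sup>+z. (2 * (indicator ?QU z *
        ennreal (\<bar>u (fst z) - u (snd z) + p \<bullet> (fst z - snd z)\<bar> * K (fst z) (snd z) / 2))
      + indicator ?QU z * ennreal (\<bar>p \<bullet> (fst z - snd z)\<bar> * K (fst z) (snd z))) \<partial>lebesgue)"
  proof (rule nn_integral_mono)
    fix z :: "(real^'n) \<times> (real^'n)"
    let ?d = "u (fst z) - u (snd z)" and ?t = "p \<bullet> (fst z - snd z)" and ?k = "K (fst z) (snd z)"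
    show "ennreal \<kappa> * (indicator ?QQ z * ennreal (\<bar>?d\<bar> * frac_kernel \<alpha> \<delta> (fst z - snd z)))
      \<le> 2 * (indicator ?QU z * ennreal (\<bar>?d + ?t\<bar> * ?k / 2)) + indicator ?QU z * ennreal (\<bar>?t\<bar> * ?k)"
    proof (cases "z \<in> ?QQ")
      case True
      then have zQU: "z \<in> ?QU" by auto
      have "\<kappa> * (\<bar>?d\<bar> * frac_kernel \<alpha> \<delta> (fst z - snd z)) = \<bar>?d\<bar> * (\<kappa> * frac_kernel \<alpha> \<delta> (fst z - snd z))" by simp
      also have "\<dots> \<le> \<bar>?d\<bar> * ?k" by (intro mult_left_mono lower) auto
      also have "\<dots> \<le> (\<bar>?d + ?t\<bar> + \<bar>?t\<bar>) * ?k" by (intro mult_right_mono K_nonneg) linarith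
      also have "\<dots> = 2 * (\<bar>?d + ?t\<bar> * ?k / 2) + \<bar>?t\<bar> * ?k" by (simp add: distrib_right)
      finally have "ennreal (\<kappa> * (\<bar>?d\<bar> * frac_kernel \<alpha> \<delta> (fst z - snd z))) \<le> ennreal (2 * (\<bar>?d + ?t\<bar> * ?k / 2) + \<bar>?t\<bar> * ?k)"
        by (rule ennreal_leI)
      also have "\<dots> = ennreal 2 * ennreal (\<bar>?d + ?t\<bar> * ?k / 2) + ennreal (\<bar>?t\<bar> * ?k)"
        using K_nonneg[of "fst z" "snd z"] by (subst ennreal_plus, simp, simp, subst ennreal_mult) auto
      finally show ?thesis using True zQU \<kappa> by (simp add: ennreal_mult)
    qed simp
  qed
  also have "\<dots> = (\<integral>\<^sup>+z. 2 * (indicator ?QU z *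
        ennreal (\<bar>u (fst z) - u (snd z) + p \<bullet> (fst z - snd z)\<bar> * K (fst z) (snd z) / 2)) \<partial>lebesgue) + tilt_energy"
    unfolding tilt_energy_def by (intro nn_integral_add) measurable
  also have "\<dots> = 2 * interaction_energy K p u + tilt_energy"
    unfolding interaction_energy_def
    by (subst nn_integral_cmult[OF interaction_integrand_measurable[OF u]]) simp
  finally show ?thesis .
qed

text \<open>\<open>R\<close> depends on neither \<open>u\<close> nor \<open>e\<close>. The forcing
  term is bounded by the threshold \<open>\<kappa> / (4 * C)\<close> times
  \<open>C * ((2 * e + R) / \<kappa>)\<close>, which is \<open>e / 2 + R / 4\<close>: it absorbs at
  most half of the interaction energy, up to a constant.\<close>

lemma coercivity:
  obtains R where "0 < R" "\<And>u e. u \<in> cell_space \<Longrightarrow> 0 \<le> e \<Longrightarrow> interaction_energy K p u \<le> ennreal e \<Longrightarrow>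
     (\<exists>v\<in>borel_measurable borel. (AE x in lborel. u x = v x) \<and> set_integrable lborel unit_cube v \<and>
        frac_seminorm \<alpha> \<delta> v \<le> ennreal ((2 * e + R) / \<kappa>) \<and>
        (\<integral>\<^sup>+x\<in>unit_cube. ennreal \<bar>v x\<bar> \<partial>lborel) \<le> ennreal (C * ((2 * e + R) / \<kappa>))) \<and>
     (\<integral>\<^sup>+x\<in>unit_cube. ennreal (\<bar>u x\<bar> powr (real CARD('n) / (real CARD('n) - \<alpha>))) \<partial>lebesgue) < \<infinity> \<and>
     \<bar>LINT x:unit_cube|lebesgue. g x * u x\<bar> \<le> e / 2 + R / 4"
proof -
  \<comment> \<open>The added 1 makes \<open>R\<close> positive, hence also \<open>j\<close> for
    \<open>e = 0\<close>, as \<open>Hoelder_bound\<close> asks for a positive bound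
    \<open>A\<close>.\<close>
  define R where "R = enn2real tilt_energy + 1"
  have R: "R > 0" "tilt_energy \<le> ennreal R"
  proof -
    have "tilt_energy = ennreal (enn2real tilt_energy)" using tilt_energy_finite by simp
    also have "\<dots> \<le> ennreal R" by (intro ennreal_leI) (simp add: R_def)
    finally show "tilt_energy \<le> ennreal R" .
  qed (simp add: R_def add_nonneg_pos)
  show thesis
  proof (rule that[OF R(1)])
    fix u :: "real^'n \<Rightarrow> real" and e :: real
    assume u: "u \<in> cell_space" and e: "0 \<le> e" "interaction_energy K p u \<le> ennreal e"
    have um[measurable]: "u \<in> borel_measurable lebesgue" by (rule cell_space_measurable[OF u])
    obtain v where v[measurable]: "v \<in> borel_measurable borel" and uv: "AE x in lborel. u x = v x"
      using completion_ex_borel_measurable_real[OF um] by auto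
    define j where "j = (2 * e + R) / \<kappa>"
    have j: "j > 0" using e R \<kappa> by (simp add: j_def)
    have "ennreal \<kappa> * frac_seminorm \<alpha> \<delta> v \<le> 2 * ennreal e + ennreal R"
      by (rule order_trans[OF frac_seminorm_le_energy[OF um v uv]]) (intro add_mono mult_left_mono e R; simp)
    also have "\<dots> = ennreal (2 * e + R)" using e R by (simp add: ennreal_plus ennreal_mult)
    finally have "ennreal (1 / \<kappa>) * (ennreal \<kappa> * frac_seminorm \<alpha> \<delta> v) \<le> ennreal (1 / \<kappa>) * ennreal (2 * e + R)"
      by (intro mult_left_mono) auto
    then have fs: "frac_seminorm \<alpha> \<delta> v \<le> ennreal j"
      using \<kappa> e R by (simp add: mult.assoc[symmetric] ennreal_mult[symmetric] j_def del: ennreal_plus)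
    have AEi: "AE x in lebesgue. indicator unit_cube x *\<^sub>R u x = indicator unit_cube x *\<^sub>R v x"
      by (rule AE_completion) (use uv in eventually_elim, simp)
    have vm: "(\<lambda>x. indicator unit_cube x *\<^sub>R v x) \<in> borel_measurable lborel" by simp
    have vm': "(\<lambda>x. indicator unit_cube x *\<^sub>R v x) \<in> borel_measurable lebesgue" by (rule measurable_completion[OF vm])
    have um': "(\<lambda>x. indicator unit_cube x *\<^sub>R u x) \<in> borel_measurable lebesgue" by measurable
    have vi: "set_integrable lborel unit_cube v"
      using cell_space_integrable[OF u] integrable_cong_AE[OF um' vm' AEi] integrable_completion[OF vm]
      by (simp add: set_integrable_def)
    have v0: "(LINT x:unit_cube|lborel. v x) = 0"
      using u integral_cong_AE[OF um' vm' AEi] integral_completion[OF vm]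
      by (simp add: set_lebesgue_integral_def cell_space_def)
    note SP = sobolev_Poincare[OF v vi v0 less_imp_le[OF j] fs]
    have "(\<integral>\<^sup>+x\<in>unit_cube. ennreal (\<bar>u x\<bar> powr (real CARD('n) / (real CARD('n) - \<alpha>))) \<partial>lebesgue) = (\<integral>\<^sup>+x\<in>unit_cube. ennreal (\<bar>u x\<bar> powr (real CARD('n) / (real CARD('n) - \<alpha>))) \<partial>lborel)"
      by (rule nn_integral_completion)
    also have "\<dots> = (\<integral>\<^sup>+x\<in>unit_cube. ennreal (\<bar>v x\<bar> powr (real CARD('n) / (real CARD('n) - \<alpha>))) \<partial>lborel)"
      by (rule nn_integral_cong_AE) (use uv in eventually_elim, simp)
    finally have uq: "(\<integral>\<^sup>+x\<in>unit_cube. ennreal (\<bar>u x\<bar> powr (real CARD('n) / (real CARD('n) - \<alpha>))) \<partial>lebesgue) \<le> ennreal ((C * j) powr (real CARD('n) / (real CARD('n) - \<alpha>)))"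
      using SP by simp
    \<comment> \<open>The conjugate exponents are \<open>n / \<alpha>\<close> and
      \<open>n / (n - \<alpha>)\<close>; the indicator is put into both factors to localize them to
      the cube.\<close>
    have H: "(\<integral>\<^sup>+x. ennreal \<bar>(indicator unit_cube x * g x) * (indicator unit_cube x * u x)\<bar> \<partial>lebesgue) \<le> ennreal (\<kappa> / (4 * C) * (C * j))"
    proof (rule Hoelder_bound)
      show "1 < real CARD('n) / \<alpha>" "1 < (real CARD('n) / (real CARD('n) - \<alpha>))" using \<alpha> by auto
      show "1 / (real CARD('n) / \<alpha>) + 1 / (real CARD('n) / (real CARD('n) - \<alpha>)) = 1" using \<alpha> by (simp add: field_simps)
      have "(\<integral>\<^sup>+x. ennreal (\<bar>indicator unit_cube x * g x\<bar> powr (real CARD('n) / \<alpha>)) \<partial>lebesgue)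
          = (\<integral>\<^sup>+x\<in>unit_cube. ennreal (\<bar>g x\<bar> powr (real CARD('n) / \<alpha>)) \<partial>lebesgue)"
        by (intro nn_integral_cong) (auto simp: indicator_def)
      then show "(\<integral>\<^sup>+x. ennreal (\<bar>indicator unit_cube x * g x\<bar> powr (real CARD('n) / \<alpha>)) \<partial>lebesgue)
          \<le> ennreal ((\<kappa> / (4 * C)) powr (real CARD('n) / \<alpha>))" using g_small by simp
      have "(\<integral>\<^sup>+x. ennreal (\<bar>indicator unit_cube x * u x\<bar> powr (real CARD('n) / (real CARD('n) - \<alpha>))) \<partial>lebesgue)
          = (\<integral>\<^sup>+x\<in>unit_cube. ennreal (\<bar>u x\<bar> powr (real CARD('n) / (real CARD('n) - \<alpha>))) \<partial>lebesgue)"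
        by (intro nn_integral_cong) (auto simp: indicator_def)
      then show "(\<integral>\<^sup>+x. ennreal (\<bar>indicator unit_cube x * u x\<bar> powr (real CARD('n) / (real CARD('n) - \<alpha>))) \<partial>lebesgue) \<le> ennreal ((C * j) powr (real CARD('n) / (real CARD('n) - \<alpha>)))"
        using uq by simp
    qed (use C j \<kappa> in auto)
    also have "\<kappa> / (4 * C) * (C * j) = e / 2 + R / 4" using C \<kappa> by (simp add: j_def field_simps)
    also have "(\<integral>\<^sup>+x. ennreal \<bar>(indicator unit_cube x * g x) * (indicator unit_cube x * u x)\<bar> \<partial>lebesgue)
       = (\<integral>\<^sup>+x. ennreal (norm (indicator unit_cube x *\<^sub>R (g x * u x))) \<partial>lebesgue)"
      by (intro nn_integral_cong) (auto simp: indicator_def)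
    finally have H': "(\<integral>\<^sup>+x. ennreal (norm (indicator unit_cube x *\<^sub>R (g x * u x))) \<partial>lebesgue) \<le> ennreal (e / 2 + R / 4)" .
    have gi: "integrable lebesgue (\<lambda>x. indicator unit_cube x *\<^sub>R (g x * u x))"
      by (rule integrableI_bounded) (measurable, use H' in \<open>auto intro: le_less_trans\<close>)
    have "ennreal \<bar>LINT x:unit_cube|lebesgue. g x * u x\<bar> \<le> ennreal (e / 2 + R / 4)"
      using order_trans[OF integral_norm_bound_ennreal[OF gi] H'] by (simp add: set_lebesgue_integral_def)
    then have gu: "\<bar>LINT x:unit_cube|lebesgue. g x * u x\<bar> \<le> e / 2 + R / 4"
      using e R by (subst (asm) ennreal_le_iff) auto
    have "(\<integral>\<^sup>+x\<in>unit_cube. ennreal (\<bar>u x\<bar> powr (real CARD('n) / (real CARD('n) - \<alpha>))) \<partial>lebesgue) < \<infinity>"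
      using uq by (auto intro: le_less_trans)
    then show "(\<exists>v\<in>borel_measurable borel. (AE x in lborel. u x = v x) \<and> set_integrable lborel unit_cube v \<and>
        frac_seminorm \<alpha> \<delta> v \<le> ennreal ((2 * e + R) / \<kappa>) \<and>
        (\<integral>\<^sup>+x\<in>unit_cube. ennreal \<bar>v x\<bar> \<partial>lborel) \<le> ennreal (C * ((2 * e + R) / \<kappa>))) \<and>
     (\<integral>\<^sup>+x\<in>unit_cube. ennreal (\<bar>u x\<bar> powr (real CARD('n) / (real CARD('n) - \<alpha>))) \<partial>lebesgue) < \<infinity> \<and>
     \<bar>LINT x:unit_cube|lebesgue. g x * u x\<bar> \<le> e / 2 + R / 4"
      using v uv vi fs SP gu unfolding j_def by blast
  qed
qed

lemma exists_minimizer: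
  "\<exists>u\<in>cell_space. (\<forall>v\<in>cell_space. cell_energy K g p u \<le> cell_energy K g p v)
     \<and> \<bar>cell_energy K g p u\<bar> \<noteq> \<infinity>
     \<and> (\<integral>\<^sup>+x\<in>unit_cube. ennreal (\<bar>u x\<bar> powr (real CARD('n) / (real CARD('n) - \<alpha>))) \<partial>lebesgue) < \<infinity>"
proof -
  let ?q = "real CARD('n) / (real CARD('n) - \<alpha>)"
  let ?E = "cell_energy K g p" and ?kin = "interaction_energy K p"
  let ?Q = "unit_cube :: (real^'n) set"
  define b where "b u = (LINT x:?Q|lebesgue. g x * u x)" for u
  have E: "?E u = enn2ereal (?kin u) + ereal (b u)" for u
    by (simp add: cell_energy_def interaction_energy_def b_def)
  have E_fin: "?E u = ereal (e + b u)" if "?kin u = ennreal e" "0 \<le> e" for u e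
    using that by (simp add: E enn2ereal_ennreal)
  have E_top: "?E u = \<infinity>" if "?kin u = top" for u
    using that by (simp add: E)
  obtain R where R: "0 < R" and coer: "\<And>u e. u \<in> cell_space \<Longrightarrow> 0 \<le> e \<Longrightarrow> ?kin u \<le> ennreal e \<Longrightarrow>
     (\<exists>v\<in>borel_measurable borel. (AE x in lborel. u x = v x) \<and> set_integrable lborel ?Q v \<and>
        frac_seminorm \<alpha> \<delta> v \<le> ennreal ((2 * e + R) / \<kappa>) \<and>
        (\<integral>\<^sup>+x\<in>?Q. ennreal \<bar>v x\<bar> \<partial>lborel) \<le> ennreal (C * ((2 * e + R) / \<kappa>))) \<and>
     (\<integral>\<^sup>+x\<in>?Q. ennreal (\<bar>u x\<bar> powr ?q) \<partial>lebesgue) < \<infinity> \<and> \<bar>b u\<bar> \<le> e / 2 + R / 4"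
    unfolding b_def by (rule coercivity) blast
  \<comment> \<open>By coercivity, \<open>e + b v \<ge> e / 2 - R / 4 \<ge> - R / 4\<close>.\<close>
  have low: "ereal (- R / 4) \<le> ?E v" if "v \<in> cell_space" for v
  proof (cases "?kin v")
    case (real e)
    then have "\<bar>b v\<bar> \<le> e / 2 + R / 4" using coer[OF that, of e] by simp
    then show ?thesis using real by (simp add: E_fin)
  qed (simp add: E_top)
  define I where "I = (INF v\<in>cell_space. ?E v)"
  have I_le: "I \<le> ?E v" if "v \<in> cell_space" for v
    unfolding I_def by (rule INF_lower[OF that])
  have zero: "(\<lambda>_. 0) \<in> (cell_space :: (real^'n \<Rightarrow> real) set)"
    by (simp add: cell_space_def Zn_periodic_def set_integrable_def set_lebesgue_integral_def)
  \<comment> \<open>The zero function is a competitor of finite energy, so the infimum is below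
    infinity.\<close>
  have "?kin (\<lambda>_. 0) \<le> tilt_energy"
    unfolding interaction_energy_def tilt_energy_def using K_nonneg
    by (intro nn_integral_mono mult_left_mono ennreal_leI) (auto simp: field_simps)
  then have "?kin (\<lambda>_. 0) < top" using tilt_energy_finite by (rule le_less_trans)
  then have "?E (\<lambda>_. 0) < \<infinity>" by (cases "?kin (\<lambda>_. 0)") (auto simp: E_fin)
  then have "I < \<infinity>" using I_le[OF zero] by (rule le_less_trans[rotated])
  moreover have "ereal (- R / 4) \<le> I" unfolding I_def by (intro INF_greatest low)
  ultimately obtain i where i: "I = ereal i" by (cases I) auto
  have "\<exists>v\<in>cell_space. ?E v < ereal (i + 1 / (real k + 1))" for k :: nat
  proof -
    have "I < ereal (i + 1 / (real k + 1))" by (simp add: i)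
    then show ?thesis unfolding I_def INF_less_iff .
  qed
  then obtain v where v: "\<And>k. v k \<in> cell_space" and Ev: "\<And>k. ?E (v k) < ereal (i + 1 / (real k + 1))"
    by metis
  define e where "e k = enn2real (?kin (v k))" for k
  have kin: "?kin (v k) = ennreal (e k)" for k
  proof (cases "?kin (v k)")
    case top
    then show ?thesis using Ev[of k] by (simp add: E_top)
  qed (simp add: e_def)
  have e0: "0 \<le> e k" for k by (simp add: e_def)
  have ev: "e k + b (v k) < i + 1 / (real k + 1)" for k
    using Ev[of k] by (simp add: E_fin[OF kin e0])
  \<comment> \<open>Obtained by solving \<open>e k / 2 - R / 4 < i + 1\<close> for
    \<open>e k\<close>.\<close>
  define es where "es = 2 * (i + 1 + R / 4)"
  have e_le: "e k \<le> es" for k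
  proof -
    have "\<bar>b (v k)\<bar> \<le> e k / 2 + R / 4" using coer[OF v[of k] e0[of k]] by (simp add: kin)
    moreover have "i + 1 / (real k + 1) \<le> i + 1" by simp
    then have "e k + b (v k) < i + 1" using ev[of k] by (rule less_le_trans[rotated])
    ultimately show ?thesis unfolding es_def by (simp add: abs_le_iff)
  qed
  have es0: "0 \<le> es" using e0[of 0] e_le[of 0] by linarith
  define J where "J = (2 * es + R) / \<kappa>"
  have J: "0 \<le> J" using es0 R \<kappa> by (simp add: J_def)
  have "\<exists>w. w \<in> borel_measurable borel \<and> (AE x in lborel. v k x = w x) \<and> set_integrable lborel ?Q w \<and>
      frac_seminorm \<alpha> \<delta> w \<le> ennreal J \<and> (\<integral>\<^sup>+x\<in>?Q. ennreal \<bar>w x\<bar> \<partial>lborel) \<le> ennreal (C * J)" for k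
    using coer[OF v[of k] es0] e_le[of k] unfolding J_def by (auto simp: kin ennreal_leI)
  then have "\<exists>w. \<forall>k. w k \<in> borel_measurable borel \<and> (AE x in lborel. v k x = w k x) \<and> set_integrable lborel ?Q (w k) \<and>
      frac_seminorm \<alpha> \<delta> (w k) \<le> ennreal J \<and> (\<integral>\<^sup>+x\<in>?Q. ennreal \<bar>w k x\<bar> \<partial>lborel) \<le> ennreal (C * J)"
    by (intro choice allI)
  then obtain w where wm[measurable]: "\<And>k. w k \<in> borel_measurable borel"
    and vw: "\<And>k. AE x in lborel. v k x = w k x" and wi: "\<And>k. set_integrable lborel ?Q (w k)"
    and wJ: "\<And>k. frac_seminorm \<alpha> \<delta> (w k) \<le> ennreal J"
    and wB: "\<And>k. (\<integral>\<^sup>+x\<in>?Q. ennreal \<bar>w k x\<bar> \<partial>lborel) \<le> ennreal (C * J)"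
    by blast
  have CJ: "0 \<le> C * J" using C J by simp
  obtain r :: "nat \<Rightarrow> nat" where r: "strict_mono r" and rC: "\<forall>e>0. \<exists>N. \<forall>k\<ge>N. \<forall>l\<ge>N.
       (\<integral>\<^sup>+x\<in>?Q. ennreal \<bar>w (r k) x - w (r l) x\<bar> \<partial>lborel) \<le> ennreal e"
    by (rule frac_seminorm_compact[of w, OF wm wi \<alpha>(1) \<delta> J wJ wB CJ])
  \<comment> \<open>Cutting off to the cube makes the sequence integrable on the whole
    space.\<close>
  define f where "f k x = indicator ?Q x *\<^sub>R v (r k) x" for k x
  have fi: "integrable lebesgue (f k)" for k
    using cell_space_integrable[OF v[of "r k"]] by (simp add: f_def[abs_def] set_integrable_def)
  have f_eq: "(\<integral>\<^sup>+x. ennreal \<bar>f k x - f l x\<bar> \<partial>lebesgue) = (\<integral>\<^sup>+x\<in>?Q. ennreal \<bar>w (r k) x - w (r l) x\<bar> \<partial>lborel)" for k l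
    unfolding nn_integral_completion
  proof (rule nn_integral_cong_AE)
    show "AE x in lborel. ennreal \<bar>f k x - f l x\<bar> = ennreal \<bar>w (r k) x - w (r l) x\<bar> * indicator ?Q x"
      using vw[of "r k"] vw[of "r l"] by eventually_elim (auto simp: f_def indicator_def)
  qed
  obtain r' :: "nat \<Rightarrow> nat" and h where r': "strict_mono r'" and h: "integrable lebesgue h"
    and fconv: "AE x in lebesgue. convergent (\<lambda>k. f (r' k) x)" and fh: "AE x in lebesgue. \<forall>k. \<bar>f (r' k) x\<bar> \<le> h x"
    by (rule L1_Cauchy_subsequence[of lebesgue f, OF fi rC[folded f_eq, rule_format]])
  define s where "s k = r (r' k)" for k
  have s_ge: "k \<le> s k" for k
    unfolding s_def using seq_suble[OF r, of "r' k"] seq_suble[OF r', of k] by linarith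
  \<comment> \<open>Off the set of convergence \<open>lim\<close> is a fixed junk value, so \<open>u\<close> is periodic at every point.\<close>
  define u where "u x = lim (\<lambda>k. v (s k) x)" for x
  have um[measurable]: "u \<in> borel_measurable lebesgue"
    unfolding u_def[abs_def] by (intro borel_measurable_lim_metric cell_space_measurable v)
  have vper: "v k (x + z) = v k x" if "\<forall>i. z $ i \<in> \<int>" for k x z
    using v[of k] that by (auto simp: cell_space_def Zn_periodic_def)
  have uper: "Zn_periodic u"
    by (simp add: Zn_periodic_def u_def vper)
  \<comment> \<open>Convergence in the cube spreads by periodicity; all of space is required because
    \<open>y\<close> ranges over all of it in the energy.\<close>
  have "AE x in lborel. convergent (\<lambda>k. v (s k) x)"
  proof (rule AE_periodic)
    show "Zn_periodic (\<lambda>x. convergent (\<lambda>k. v (s k) x))" by (simp add: Zn_periodic_def vper)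
    have "AE x in lborel. convergent (\<lambda>k. f (r' k) x)" using fconv by (simp add: AE_completion_iff)
    then show "AE x in lborel. x \<in> ?Q \<longrightarrow> convergent (\<lambda>k. v (s k) x)"
      by eventually_elim (auto simp: f_def s_def)
  qed
  then have conv: "AE x in lborel. (\<lambda>k. v (s k) x) \<longlonglongrightarrow> u x"
    by eventually_elim (simp add: u_def convergent_LIMSEQ_iff)
  then have conv': "AE x in lebesgue. (\<lambda>k. v (s k) x) \<longlonglongrightarrow> u x" by (rule AE_completion)
  have vm[measurable]: "v k \<in> borel_measurable lebesgue" for k by (rule cell_space_measurable[OF v])
  have lim1: "AE x in lebesgue. (\<lambda>k. indicator ?Q x *\<^sub>R v (s k) x) \<longlonglongrightarrow> indicator ?Q x *\<^sub>R u x"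
    using conv' by eventually_elim (intro tendsto_intros)
  have dom1: "AE x in lebesgue. norm (indicator ?Q x *\<^sub>R v (s k) x) \<le> h x" for k
    using fh by eventually_elim (simp add: f_def s_def)
  have ui: "set_integrable lebesgue ?Q u"
    unfolding set_integrable_def
    by (rule integrable_dominated_convergence[OF _ _ h lim1 dom1]) measurable
  have "(\<lambda>k. LINT x:?Q|lebesgue. v (s k) x) \<longlonglongrightarrow> (LINT x:?Q|lebesgue. u x)"
    unfolding set_lebesgue_integral_def
    by (rule integral_dominated_convergence[OF _ _ h lim1 dom1]) measurable
  moreover have "(LINT x:?Q|lebesgue. v (s k) x) = 0" for k using v by (auto simp: cell_space_def)
  ultimately have u0: "(LINT x:?Q|lebesgue. u x) = 0" by (simp add: LIMSEQ_const_iff)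
  have u: "u \<in> cell_space"
    using periodic_locally_integrable[OF um uper ui] uper u0 by (simp add: cell_space_def)
  have lim2: "AE x in lebesgue. (\<lambda>k. indicator ?Q x *\<^sub>R (g x * v (s k) x)) \<longlonglongrightarrow> indicator ?Q x *\<^sub>R (g x * u x)"
    using conv' by eventually_elim (intro tendsto_intros)
  have dom2: "AE x in lebesgue. norm (indicator ?Q x *\<^sub>R (g x * v (s k) x)) \<le> M * h x" for k
    using g_bounded dom1[of k]
  proof eventually_elim
    case (elim x)
    have "norm (indicator ?Q x *\<^sub>R (g x * v (s k) x)) = \<bar>g x\<bar> * norm (indicator ?Q x *\<^sub>R v (s k) x)"
      by (simp add: abs_mult)
    also have "\<dots> \<le> M * h x" using elim by (intro mult_mono) auto
    finally show ?case .
  qed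
  have "integrable lebesgue (\<lambda>x. M * h x)" using h by simp
  then have bconv: "(\<lambda>k. b (v (s k))) \<longlonglongrightarrow> b u"
    unfolding b_def set_lebesgue_integral_def
    by (rule integral_dominated_convergence[OF _ _ _ lim2 dom2, rotated 2]) measurable
  let ?F = "\<lambda>u z. indicator (?Q \<times> UNIV) z *
     ennreal (\<bar>u (fst z) - u (snd z) + p \<bullet> (fst z - snd z)\<bar> * K (fst z) (snd z) / 2)"
  have Flim: "AE z in lborel. ?F u z = liminf (\<lambda>k. ?F (v (s k)) z)"
    using AE_lborel_fst[OF conv] AE_lborel_snd[OF conv]
  proof eventually_elim
    case (elim z)
    have "(\<lambda>k. \<bar>v (s k) (fst z) - v (s k) (snd z) + p \<bullet> (fst z - snd z)\<bar> * K (fst z) (snd z) / 2)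
      \<longlonglongrightarrow> \<bar>u (fst z) - u (snd z) + p \<bullet> (fst z - snd z)\<bar> * K (fst z) (snd z) / 2"
      using elim by (intro tendsto_intros) auto
    then have "(\<lambda>k. ?F (v (s k)) z) \<longlonglongrightarrow> ?F u z"
      by (cases "z \<in> ?Q \<times> UNIV") (auto intro!: tendsto_ennrealI)
    then show ?case by (intro lim_imp_Liminf[symmetric]) auto
  qed
  \<comment> \<open>An upper bound for the interaction energies along the subsequence which, unlike
    these, is known to converge.\<close>
  define d where "d k = i + 1 / (real (s k) + 1) - b (v (s k))" for k
  have "(\<lambda>k. 1 / (real (s k) + 1)) \<longlonglongrightarrow> 0"
  proof (rule tendsto_sandwich[OF _ _ tendsto_const])
    show "(\<lambda>k. 1 / (real k + 1)) \<longlonglongrightarrow> 0" using LIMSEQ_inverse_real_of_nat by (simp add: inverse_eq_divide add.commute)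
    show "\<forall>\<^sub>F k in sequentially. 1 / (real (s k) + 1) \<le> 1 / (real k + 1)"
      using s_ge by (intro always_eventually allI divide_left_mono) auto
  qed auto
  then have "d \<longlonglongrightarrow> i + 0 - b u"
    unfolding d_def[abs_def] by (intro tendsto_intros bconv)
  then have d: "d \<longlonglongrightarrow> i - b u" by simp
  have ed: "e (s k) \<le> d k" for k using ev[of "s k"] by (simp add: d_def)
  \<comment> \<open>Nonnegativity makes \<open>ennreal (i - b u)\<close> faithful, since
    \<open>ennreal\<close> sends negative numbers to 0.\<close>
  have ib: "0 \<le> i - b u"
    by (rule LIMSEQ_le_const[OF d]) (use ed e0 order_trans in blast)
  have "?kin u = (\<integral>\<^sup>+z. ?F u z \<partial>lebesgue)" by (simp add: interaction_energy_def)
  also have "\<dots> = (\<integral>\<^sup>+z. liminf (\<lambda>k. ?F (v (s k)) z) \<partial>lebesgue)"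
    by (rule nn_integral_cong_AE[OF AE_completion[OF Flim]])
  also have "\<dots> \<le> liminf (\<lambda>k. \<integral>\<^sup>+z. ?F (v (s k)) z \<partial>lebesgue)"
    by (intro nn_integral_liminf interaction_integrand_measurable vm)
  also have "\<dots> = liminf (\<lambda>k. ennreal (e (s k)))"
    unfolding kin[symmetric] interaction_energy_def ..
  also have "\<dots> \<le> liminf (\<lambda>k. ennreal (d k))"
    using ed by (intro Liminf_mono always_eventually allI ennreal_leI) auto
  also have "\<dots> = ennreal (i - b u)"
    by (intro lim_imp_Liminf tendsto_ennrealI d) auto
  finally have kin_u: "?kin u \<le> ennreal (i - b u)" .
  then obtain eu where eu: "?kin u = ennreal eu" "0 \<le> eu"
    by (cases "?kin u") (auto simp: top_unique)
  have "eu \<le> i - b u" using kin_u ib unfolding eu by simp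
  then have Eu: "?E u \<le> I" by (simp add: E_fin[OF eu] i)
  have "?E u = I" using Eu I_le[OF u] by (rule antisym)
  then have "\<bar>?E u\<bar> \<noteq> \<infinity>" by (simp add: i)
  moreover have "\<forall>v\<in>cell_space. ?E u \<le> ?E v" using Eu I_le order_trans by blast
  \<comment> \<open>Coercivity once more, for the minimizer itself with
    \<open>e = i - b u\<close>.\<close>
  moreover have "(\<integral>\<^sup>+x\<in>?Q. ennreal (\<bar>u x\<bar> powr ?q) \<partial>lebesgue) < \<infinity>"
    using coer[OF u ib kin_u] by blast
  ultimately show ?thesis by (intro bexI[OF _ u] conjI)
qed

end

section \<open>Choice of the smallness threshold and reduction to the cell problem with fixed
  data\<close>

theorem mainTheorem1:
  fixes s1 \<kappa>1 \<delta> :: real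
  assumes "CARD('n) \<ge> 2"
    and "0 < s1" "s1 < 1/2" "0 < \<kappa>1" "0 < \<delta>"
  shows "\<exists>\<gamma>>0. \<forall>(K :: real^'n \<Rightarrow> real^'n \<Rightarrow> real) s2 \<kappa>2 \<kappa>3 g.
           kernel_K0 K \<and> kernel_K1 K \<and> kernel_K2 K \<and> kernel_K3 K s1 s2 \<delta> \<kappa>1 \<kappa>2 \<and> kernel_K4 K \<kappa>3
           \<and> admissible_forcing g
           \<and> (LINT x:unit_cube|lebesgue. \<bar>g x\<bar> powr (real CARD('n) / (2 * s1)))
                 powr (2 * s1 / real CARD('n)) \<le> \<gamma>
           \<longrightarrow> (\<forall>p. \<exists>u\<in>cell_space.
                  (\<forall>v\<in>cell_space. cell_energy K g p u \<le> cell_energy K g p v)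
                  \<and> \<bar>cell_energy K g p u\<bar> \<noteq> \<infinity>
                  \<and> (\<integral>\<^sup>+ x\<in>unit_cube. ennreal (\<bar>u x\<bar> powr (real CARD('n) / (real CARD('n) - 2 * s1))) \<partial>lebesgue) < \<infinity>)"
proof -
  let ?n = "real CARD('n)"
  define \<alpha> where "\<alpha> = 2 * s1"
  have "2 \<le> ?n" using assms(1) by simp
  then have \<alpha>: "0 < \<alpha>" "\<alpha> < ?n" using assms by (auto simp: \<alpha>_def)
  obtain C where C: "C > 0" and SP:
    "\<And>(u :: real^'n \<Rightarrow> real) j. u \<in> borel_measurable borel \<Longrightarrow> set_integrable lborel unit_cube u \<Longrightarrow>
       (LINT x:unit_cube|lborel. u x) = 0 \<Longrightarrow> 0 \<le> j \<Longrightarrow> frac_seminorm \<alpha> \<delta> u \<le> ennreal j \<Longrightarrow>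
       (\<integral>\<^sup>+x\<in>unit_cube. ennreal \<bar>u x\<bar> \<partial>lborel) \<le> ennreal (C * j) \<and>
       (\<integral>\<^sup>+x\<in>unit_cube. ennreal (\<bar>u x\<bar> powr (?n / (?n - \<alpha>))) \<partial>lborel)
         \<le> ennreal ((C * j) powr (?n / (?n - \<alpha>)))"
    by (rule sobolev_Poincare[OF \<alpha> \<open>0 < \<delta>\<close>]) blast
  \<comment> \<open>\<open>C\<close> depends only on the dimension, \<alpha> and \<delta>, so
    \<gamma> is fixed before the kernel and the forcing term.\<close>
  define \<gamma> where "\<gamma> = \<kappa>1 / (4 * C)"
  have \<gamma>: "\<gamma> > 0" using C assms by (simp add: \<gamma>_def)
  show ?thesis
  proof (intro exI[of _ \<gamma>] conjI \<gamma> allI impI)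
    fix K :: "real^'n \<Rightarrow> real^'n \<Rightarrow> real" and s2 \<kappa>2 \<kappa>3 :: real and g :: "real^'n \<Rightarrow> real" and p :: "real^'n"
    assume H: "kernel_K0 K \<and> kernel_K1 K \<and> kernel_K2 K \<and> kernel_K3 K s1 s2 \<delta> \<kappa>1 \<kappa>2 \<and> kernel_K4 K \<kappa>3
           \<and> admissible_forcing g
           \<and> (LINT x:unit_cube|lebesgue. \<bar>g x\<bar> powr (?n / (2 * s1))) powr (2 * s1 / ?n) \<le> \<gamma>"
    then have Kg: "kernel_K0 K" "kernel_K1 K" "kernel_K2 K" "g \<in> borel_measurable lebesgue"
      by (auto simp: admissible_forcing_def)
    note [measurable] = Kg(4)
    obtain M where M: "AE x in lebesgue. \<bar>g x\<bar> \<le> M" using H by (auto simp: admissible_forcing_def)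
    interpret cell_problem K g p \<alpha> \<delta> \<kappa>1 C M
    proof
      show "\<kappa>1 * frac_kernel \<alpha> \<delta> (x - y) \<le> K x y" for x y
      proof (cases "x = y")
        case True
        then show ?thesis using H by (simp add: frac_kernel_def kernel_K0_def)
      next
        case False
        then have "(if dist x y < \<delta> then \<kappa>1 * dist x y powr (- (?n + 2 * s1)) else 0) \<le> K x y"
          using H by (auto simp: kernel_K3_def)
        then show ?thesis by (simp add: frac_kernel_def dist_norm \<alpha>_def split: if_splits)
      qed
      let ?G = "\<lambda>x. indicator unit_cube x *\<^sub>R \<bar>g x\<bar> powr (?n / \<alpha>)"
      \<comment> \<open>Since \<open>g\<close> is bounded, the integral in the smallness hypothesis
        is a genuine one, not the default value 0 of a non-integrable function, and equals the
        nonnegative integral.\<close>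
      have "integrable lebesgue ?G"
      proof (rule Bochner_Integration.integrable_bound)
        show "integrable lebesgue (\<lambda>x. (M powr (?n / \<alpha>)) * indicator unit_cube x :: real)"
          by (intro integrable_mult_right integrable_real_indicator)
             (auto simp: emeasure_unit_cube)
        show "AE x in lebesgue. norm (?G x) \<le> norm ((M powr (?n / \<alpha>)) * indicator unit_cube x :: real)"
          using M by eventually_elim (use \<alpha> in \<open>auto simp: indicator_def intro!: powr_mono2\<close>)
      qed measurable
      then have G1: "(\<integral>\<^sup>+x. ennreal (?G x) \<partial>lebesgue) = ennreal (LINT x:unit_cube|lebesgue. \<bar>g x\<bar> powr (?n / \<alpha>))"
        unfolding set_lebesgue_integral_def by (intro nn_integral_eq_integral) auto
      have G2: "(\<integral>\<^sup>+x. ennreal (?G x) \<partial>lebesgue) = (\<integral>\<^sup>+x\<in>unit_cube. ennreal (\<bar>g x\<bar> powr (?n / \<alpha>)) \<partial>lebesgue)"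
        by (intro nn_integral_cong) (auto simp: indicator_def)
      \<comment> \<open>Undoes the outer exponent \<open>\<alpha> / n\<close> of the norm.\<close>
      have G3: "(LINT x:unit_cube|lebesgue. \<bar>g x\<bar> powr (?n / \<alpha>)) \<le> \<gamma> powr (?n / \<alpha>)"
      proof -
        let ?L = "LINT x:unit_cube|lebesgue. \<bar>g x\<bar> powr (?n / \<alpha>)"
        have L: "0 \<le> ?L" unfolding set_lebesgue_integral_def by (intro integral_nonneg_AE) auto
        have "?L = (?L powr (\<alpha> / ?n)) powr (?n / \<alpha>)" using L \<alpha> by (simp add: powr_powr)
        also have "\<dots> \<le> \<gamma> powr (?n / \<alpha>)"
          using H \<alpha> by (intro powr_mono2) (auto simp: \<alpha>_def)
        finally show ?thesis .
      qed
      show "(\<integral>\<^sup>+x\<in>unit_cube. ennreal (\<bar>g x\<bar> powr (?n / \<alpha>)) \<partial>lebesgue) \<le> ennreal ((\<kappa>1 / (4 * C)) powr (?n / \<alpha>))"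
        using ennreal_leI[OF G3] unfolding G1[symmetric] G2 \<gamma>_def .
    qed (fact Kg \<alpha> C M assms | (rule SP; assumption))+
    show "\<exists>u\<in>cell_space. (\<forall>v\<in>cell_space. cell_energy K g p u \<le> cell_energy K g p v)
        \<and> \<bar>cell_energy K g p u\<bar> \<noteq> \<infinity>
        \<and> (\<integral>\<^sup>+ x\<in>unit_cube. ennreal (\<bar>u x\<bar> powr (?n / (?n - 2 * s1))) \<partial>lebesgue) < \<infinity>"
      using exists_minimizer unfolding \<alpha>_def .
  qed
qed

end
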